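(* (1) Let $X,Y$ be Banach spaces, $T\in\mathcal{L}(X,Y)$ and $1\leq p\leq\infty$. If $T^{**}$ is unconditionally $p$-converging, then $T$ is unconditionally $p$-converging. (2) For each $1\leq p\leq\infty$ there exists an unconditionally $p$-converging operator $T$ (between some Banach spaces) such that $T^{**}$ is not unconditionally $p$-converging.
   Context: Banach spaces are real or complex; an operator is a continuous linear map; $\mathcal{L}(X,Y)$ is the space of operators from $X$ to $Y$; $B_{X^{*}}$ is the closed unit ball of $X^{*}$. For $1\leq p<\infty$, a sequence $(x_n)_n$ in $X$ is weakly $p$-summable, written $(x_n)_n\in l_p^w(X)$, if $\sup\{(\sum_{n=1}^{\infty}|\langle x^*,x_n\rangle|^p)^{1/p}:x^*\in B_{X^*}\}<\infty$; it is unconditionally $p$-summable, written $(x_n)_n\in l_p^u(X)$, if moreover $\sup\{(\sum_{n=m}^{\infty}|\langle x^*,x_n\rangle|^p)^{1/p}:x^*\in B_{X^*}\}\to 0$ as $m\to\infty$. For $1\le p<\infty$, an operator $T:X\to Y$ is unconditionally $p$-converging if $(Tx_n)_n\in l_p^u(Y)$ for every $(x_n)_n\in l_p^w(X)$; for $p=\infty$, $T$ is unconditionally $\infty$-converging if it maps weakly null sequences to norm null sequences. *)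

theory Defs
  imports "HOL-Analysis.Analysis" "HOL-Library.Function_Algebras"
begin

text \<open>
  Normed spaces over a scalar field \<open>'k\<close> (used with \<open>real\<close> and \<open>complex\<close>) are represented by a
  linear subspace \<open>carr X\<close> of an ambient \<open>'k\<close>-vector space, together with a norm which is only
  meaningful on \<open>carr X\<close>.  Unlike the class \<^class>\<open>banach\<close>, this covers complex scalars and allows
  quantifying existentially over Banach spaces.  The ambient type of a dual space is a
  function type, whose pointwise group structure comes from \<^theory>\<open>HOL-Library.Function_Algebras\<close>.
\<close>

record ('k, 'a) nspace =
  carr :: "'a set"
  scal :: "'k \<Rightarrow> 'a \<Rightarrow> 'a"
  nrm :: "'a \<Rightarrow> real"

definition normed_space :: "('k::real_normed_field, 'a::ab_group_add) nspace \<Rightarrow> bool" where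
  "normed_space X \<longleftrightarrow>
     vector_space (scal X) \<and> module.subspace (scal X) (carr X) \<and>
     (\<forall>x\<in>carr X. nrm X x = 0 \<longleftrightarrow> x = 0) \<and>
     (\<forall>x\<in>carr X. \<forall>y\<in>carr X. nrm X (x + y) \<le> nrm X x + nrm X y) \<and>
     (\<forall>c. \<forall>x\<in>carr X. nrm X (scal X c x) = norm c * nrm X x)"

text \<open>The value off the carrier is immaterial; the locale \<^locale>\<open>Metric_space\<close> asks for
  non-negativity and symmetry on the whole type.\<close>

definition ndist :: "('k, 'a::ab_group_add) nspace \<Rightarrow> 'a \<Rightarrow> 'a \<Rightarrow> real" where
  "ndist X x y = (if x \<in> carr X \<and> y \<in> carr X then nrm X (x - y) else 0)"

definition banach_space :: "('k::real_normed_field, 'a::ab_group_add) nspace \<Rightarrow> bool" where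
  "banach_space X \<longleftrightarrow> normed_space X \<and> Metric_space.mcomplete (carr X) (ndist X)"

lemma normed_spaceD:
  assumes "normed_space X"
  shows "vector_space (scal X)" "module.subspace (scal X) (carr X)"
    "x \<in> carr X \<Longrightarrow> nrm X x = 0 \<longleftrightarrow> x = 0"
    "\<lbrakk>x \<in> carr X; y \<in> carr X\<rbrakk> \<Longrightarrow> nrm X (x + y) \<le> nrm X x + nrm X y"
    "x \<in> carr X \<Longrightarrow> nrm X (scal X c x) = norm c * nrm X x"
  using assms by (auto simp: normed_space_def)

lemma normed_space_closed:
  assumes "normed_space X"
  shows "0 \<in> carr X" "\<lbrakk>x \<in> carr X; y \<in> carr X\<rbrakk> \<Longrightarrow> x + y \<in> carr X"
    "\<lbrakk>x \<in> carr X; y \<in> carr X\<rbrakk> \<Longrightarrow> x - y \<in> carr X"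
    "x \<in> carr X \<Longrightarrow> - x \<in> carr X" "x \<in> carr X \<Longrightarrow> scal X c x \<in> carr X"
proof -
  interpret vector_space "scal X" using assms by (rule normed_spaceD)
  show "0 \<in> carr X" "\<lbrakk>x \<in> carr X; y \<in> carr X\<rbrakk> \<Longrightarrow> x + y \<in> carr X"
    "\<lbrakk>x \<in> carr X; y \<in> carr X\<rbrakk> \<Longrightarrow> x - y \<in> carr X"
    "x \<in> carr X \<Longrightarrow> - x \<in> carr X" "x \<in> carr X \<Longrightarrow> scal X c x \<in> carr X"
    using normed_spaceD(2)[OF assms]
    by (auto intro: subspace_0 subspace_add subspace_diff subspace_neg subspace_scale)
qed

lemma nrm_minus:
  assumes "normed_space X" "x \<in> carr X"
  shows "nrm X (- x) = nrm X x"
proof -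
  interpret vector_space "scal X" using assms(1) by (rule normed_spaceD)
  have "- x = scal X (-1) x" by simp
  then show ?thesis using normed_spaceD(5)[OF assms, of "-1"] by simp
qed

lemma nrm_nonneg:
  assumes "normed_space X" "x \<in> carr X"
  shows "0 \<le> nrm X x"
  using normed_spaceD(3)[OF assms(1), of 0] normed_spaceD(4)[OF assms(1), of x "-x"]
    nrm_minus[OF assms] normed_space_closed[OF assms(1)] assms(2) by fastforce

lemma Metric_space_ndist:
  assumes X: "normed_space X"
  shows "Metric_space (carr X) (ndist X)"
proof
  note cl = normed_space_closed[OF X]
  show "0 \<le> ndist X x y" for x y
    using nrm_nonneg[OF X] cl by (auto simp: ndist_def)
  show "ndist X x y = ndist X y x" for x y
    using nrm_minus[OF X, of "x - y"] cl by (auto simp: ndist_def)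
  show "ndist X x y = 0 \<longleftrightarrow> x = y" if "x \<in> carr X" "y \<in> carr X" for x y
    using normed_spaceD(3)[OF X, of "x - y"] cl that by (auto simp: ndist_def)
  show "ndist X x z \<le> ndist X x y + ndist X y z" if "x \<in> carr X" "y \<in> carr X" "z \<in> carr X" for x y z
    using normed_spaceD(4)[OF X, of "x - y" "y - z"] cl that by (auto simp: ndist_def)
qed

text \<open>The class-based real Banach spaces are an instance.\<close>

lemma banach_space_UNIV:
  "banach_space \<lparr>carr = UNIV, scal = scaleR, nrm = (norm :: 'a::banach \<Rightarrow> real)\<rparr>" (is "banach_space ?X")
proof -
  have "normed_space ?X"
    using real_vector.vector_space_axioms
    by (auto simp: normed_space_def norm_triangle_ineq module.subspace_def real_vector.module_axioms)
  moreover have "ndist ?X = dist"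
    by (auto simp: ndist_def fun_eq_iff dist_norm)
  ultimately show ?thesis
    using complete_UNIV by (auto simp: banach_space_def mcomplete_iff_complete)
qed

definition ntopology :: "('k, 'a::ab_group_add) nspace \<Rightarrow> 'a topology" where
  "ntopology X = Metric_space.mtopology (carr X) (ndist X)"

definition operators ::
  "('k, 'a::ab_group_add) nspace \<Rightarrow> ('k, 'b::ab_group_add) nspace \<Rightarrow> ('a \<Rightarrow> 'b) set" where
  "operators X Y = {T. T ` carr X \<subseteq> carr Y \<and>
     (\<forall>x\<in>carr X. \<forall>y\<in>carr X. T (x + y) = T x + T y) \<and>
     (\<forall>c. \<forall>x\<in>carr X. T (scal X c x) = scal Y c (T x)) \<and>
     continuous_map (ntopology X) (ntopology Y) T}"

definition scalar_space :: "('k::real_normed_field, 'k) nspace" where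
  "scalar_space = \<lparr>carr = UNIV, scal = (*), nrm = norm\<rparr>"

definition unit_ball :: "('k, 'a) nspace \<Rightarrow> 'a set" where
  "unit_ball X = {x \<in> carr X. nrm X x \<le> 1}"

text \<open>Functionals are normalised to be 0 off the carrier, so that two functionals
  agreeing on \<open>carr X\<close> are equal.\<close>

definition dual :: "('k::real_normed_field, 'a::ab_group_add) nspace \<Rightarrow> ('k, 'a \<Rightarrow> 'k) nspace" where
  "dual X = \<lparr>carr = {f \<in> operators X scalar_space. \<forall>x. x \<notin> carr X \<longrightarrow> f x = 0},
             scal = (\<lambda>c f x. c * f x),
             nrm = (\<lambda>f. SUP x\<in>unit_ball X. norm (f x))\<rparr>"

text \<open>For \<open>T\<close> from \<open>X\<close> to \<open>Y\<close> this is the operator from \<open>dual Y\<close> to \<open>dual X\<close>.\<close>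

definition adjoint_op :: "('k, 'a) nspace \<Rightarrow> ('a \<Rightarrow> 'b) \<Rightarrow> ('b \<Rightarrow> 'k::real_normed_field) \<Rightarrow> ('a \<Rightarrow> 'k)" where
  "adjoint_op X T g = (\<lambda>x. if x \<in> carr X then g (T x) else 0)"

abbreviation bidual :: "('k::real_normed_field, 'a::ab_group_add) nspace \<Rightarrow> ('k, ('a \<Rightarrow> 'k) \<Rightarrow> 'k) nspace" where
  "bidual X \<equiv> dual (dual X)"

definition biadjoint_op ::
  "('k::real_normed_field, 'a::ab_group_add) nspace \<Rightarrow> ('k, 'b::ab_group_add) nspace \<Rightarrow> ('a \<Rightarrow> 'b)
     \<Rightarrow> (('a \<Rightarrow> 'k) \<Rightarrow> 'k) \<Rightarrow> (('b \<Rightarrow> 'k) \<Rightarrow> 'k)" where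
  "biadjoint_op X Y T = adjoint_op (dual Y) (adjoint_op X T)"

text \<open>Finiteness of the supremum includes convergence of each of the series, which has to be
  said explicitly since \<^const>\<open>suminf\<close> and \<^const>\<open>Sup\<close> are total on the reals.\<close>

definition weakly_summable ::
  "real \<Rightarrow> ('k::real_normed_field, 'a::ab_group_add) nspace \<Rightarrow> (nat \<Rightarrow> 'a) \<Rightarrow> bool" where
  "weakly_summable p X x \<longleftrightarrow>
     (\<forall>n. x n \<in> carr X) \<and>
     (\<forall>f\<in>unit_ball (dual X). summable (\<lambda>n. norm (f (x n)) powr p)) \<and>
     bdd_above ((\<lambda>f. (\<Sum>n. norm (f (x n)) powr p) powr (1 / p)) ` unit_ball (dual X))"

definition uncond_summable ::
  "real \<Rightarrow> ('k::real_normed_field, 'a::ab_group_add) nspace \<Rightarrow> (nat \<Rightarrow> 'a) \<Rightarrow> bool" where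
  "uncond_summable p X x \<longleftrightarrow>
     weakly_summable p X x \<and>
     (\<lambda>m. SUP f\<in>unit_ball (dual X). (\<Sum>n. norm (f (x (n + m))) powr p) powr (1 / p)) \<longlonglongrightarrow> 0"

definition weakly_null ::
  "('k::real_normed_field, 'a::ab_group_add) nspace \<Rightarrow> (nat \<Rightarrow> 'a) \<Rightarrow> bool" where
  "weakly_null X x \<longleftrightarrow> (\<forall>n. x n \<in> carr X) \<and> (\<forall>f\<in>carr (dual X). (\<lambda>n. f (x n)) \<longlonglongrightarrow> 0)"

definition norm_null :: "('k, 'a) nspace \<Rightarrow> (nat \<Rightarrow> 'a) \<Rightarrow> bool" where
  "norm_null X x \<longleftrightarrow> (\<forall>n. x n \<in> carr X) \<and> (\<lambda>n. nrm X (x n)) \<longlonglongrightarrow> 0"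

definition uncond_converging ::
  "ereal \<Rightarrow> ('k::real_normed_field, 'a::ab_group_add) nspace \<Rightarrow> ('k, 'b::ab_group_add) nspace
     \<Rightarrow> ('a \<Rightarrow> 'b) \<Rightarrow> bool" where
  "uncond_converging p X Y T \<longleftrightarrow>
     (if p = \<infinity>
      then \<forall>x. weakly_null X x \<longrightarrow> norm_null Y (\<lambda>n. T (x n))
      else \<forall>x. weakly_summable (real_of_ereal p) X x \<longrightarrow>
               uncond_summable (real_of_ereal p) Y (\<lambda>n. T (x n)))"

end

theory Submission
  imports Defs
begin

text \<open>
  Part (1) rests on the canonical embedding \<open>J\<close> of a space into its bidual. It is a contraction, so it
  carries weakly \<open>p\<close>-summable (weakly null) sequences of \<open>X\<close> to such sequences of the bidual, and
  \<open>T\<^sup>*\<^sup>* J = J T\<close>. If the biadjoint is unconditionally \<open>p\<close>-converging, the sequence \<open>J (T x\<^sub>n)\<close> is therefore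
  unconditionally \<open>p\<close>-summable, and evaluation at a functional on \<open>Y\<close> is a functional on the bidual of
  \<open>Y\<close> of no larger norm, so the tails for \<open>T x\<^sub>n\<close> are dominated by those for \<open>J (T x\<^sub>n)\<close>
  (\<open>uncond_converging_of_biadjoint\<close>). For \<open>p = \<infinity>\<close> the norm of \<open>T x\<^sub>n\<close> itself has to be recovered from the
  norm of \<open>J (T x\<^sub>n)\<close>; this is the one place where the Hahn--Banach theorem enters.

  For part (2) a single example serves every \<open>p\<close>: the identity of \<open>X = (\<Oplus>\<^sub>d l\<^sub>\<infinity>\<^sup>d\<^sup>+\<^sup>1)\<^sub>1\<close>, the \<open>l\<^sub>1\<close>-sum of the
  finite-dimensional sup-norm spaces. As an \<open>l\<^sub>1\<close>-sum of finite-dimensional spaces \<open>X\<close> has the Schur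
  property, by a gliding hump (\<open>schur_property_l1_linf\<close>). The Schur property alone makes the identity
  unconditionally \<open>p\<close>-converging for all \<open>p\<close>: if the tails of a weakly \<open>p\<close>-summable sequence did not tend
  to zero uniformly on the dual ball, then coefficients extremal in Hoelder's inequality would combine
  blocks further and further out into a weakly null sequence that is bounded away from zero in norm
  (\<open>schur_imp_uncond_summable\<close>).

  The biadjoint of the identity is the identity of the bidual, which is not Schur: as \<open>d\<close> grows, the
  unit vectors of \<open>l\<^sub>\<infinity>\<^sup>d\<^sup>+\<^sup>1\<close> approximate those of \<open>c\<^sub>0\<close>. Precisely, let \<open>\<phi>\<^sub>k\<close> be the generalized limit over \<open>d\<close> of
  the \<open>k\<close>-th unit vectors of the \<open>d\<close>-th summands, viewed in the bidual. Sums \<open>\<Sum> a\<^sub>k \<phi>\<^sub>k\<close> with \<open>\<bar>a\<^sub>k\<bar> \<le> 1\<close> have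
  norm at most one, because this already holds inside each \<open>l\<^sub>\<infinity>\<^sup>d\<^sup>+\<^sup>1\<close>. Hence \<open>(\<phi>\<^sub>k)\<close> is weakly 1-summable,
  thus weakly \<open>p\<close>-summable for every \<open>p\<close> and weakly null; yet the functional summing the \<open>k\<close>-th coordinates
  takes the value one at \<open>\<phi>\<^sub>k\<close> (\<open>bidual_l1_linf_not_uncond_converging\<close>).
\<close>

section \<open>Operators and dual spaces\<close>

lemma scalar_space_simps [simp]:
  "carr scalar_space = UNIV" "scal scalar_space = (*)" "nrm scalar_space = norm"
  by (simp_all add: scalar_space_def)

lemma normed_scalar_space: "normed_space (scalar_space :: ('k::real_normed_field, 'k) nspace)"
proof -
  have "vector_space ((*) :: 'k \<Rightarrow> 'k \<Rightarrow> 'k)"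
    by standard (simp_all add: algebra_simps)
  then show ?thesis
    by (simp add: normed_space_def norm_triangle_ineq norm_mult module.subspace_def
      vector_space_over_itself.module_axioms)
qed

lemma operators_zero:
  assumes "normed_space X" "T \<in> operators X Y"
  shows "T 0 = 0"
proof -
  have "T (0 + 0) = T 0 + T 0"
    using assms normed_space_closed(1)[OF assms(1)] unfolding operators_def by blast
  then show ?thesis by simp
qed

lemma operatorsI:
  assumes X: "normed_space X" and Y: "normed_space Y"
    and into: "\<And>x. x \<in> carr X \<Longrightarrow> T x \<in> carr Y"
    and add: "\<And>x y. x \<in> carr X \<Longrightarrow> y \<in> carr X \<Longrightarrow> T (x + y) = T x + T y"
    and scale: "\<And>c x. x \<in> carr X \<Longrightarrow> T (scal X c x) = scal Y c (T x)"
    and bound: "\<And>x. x \<in> carr X \<Longrightarrow> nrm Y (T x) \<le> C * nrm X x"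
  shows "T \<in> operators X Y"
proof -
  interpret MX: Metric_space "carr X" "ndist X" by (rule Metric_space_ndist[OF X])
  interpret vx: vector_space "scal X" using X by (rule normed_spaceD)
  interpret vy: vector_space "scal Y" using Y by (rule normed_spaceD)
  note cl = normed_space_closed[OF X]
  have neg: "T (- x) = - T x" if "x \<in> carr X" for x
    using scale[OF that, of "-1"] by simp
  have diff: "T (x - y) = T x - T y" if "x \<in> carr X" "y \<in> carr X" for x y
    using add[of x "- y"] neg[of y] that cl(4)[of y] by simp
  have "\<exists>\<delta>>0. \<forall>x. x \<in> carr X \<and> ndist X a x < \<delta> \<longrightarrow> ndist Y (T a) (T x) < \<epsilon>"
    if a: "a \<in> carr X" and e: "\<epsilon> > 0" for a \<epsilon>
  proof (intro exI[of _ "\<epsilon> / (\<bar>C\<bar> + 1)"] conjI allI impI)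
    show "0 < \<epsilon> / (\<bar>C\<bar> + 1)" using e by simp
    fix x assume x: "x \<in> carr X \<and> ndist X a x < \<epsilon> / (\<bar>C\<bar> + 1)"
    then have d: "a - x \<in> carr X" using a cl by auto
    have n: "nrm X (a - x) < \<epsilon> / (\<bar>C\<bar> + 1)" "0 \<le> nrm X (a - x)"
      using x a nrm_nonneg[OF X d] by (auto simp: ndist_def)
    have "ndist Y (T a) (T x) = nrm Y (T (a - x))"
      using x a into diff by (simp add: ndist_def)
    also have "\<dots> \<le> C * nrm X (a - x)" by (rule bound[OF d])
    also have "\<dots> \<le> (\<bar>C\<bar> + 1) * nrm X (a - x)"
      using n(2) by (intro mult_right_mono) auto
    also have "\<dots> < \<epsilon>" using n(1) by (simp add: field_simps)
    finally show "ndist Y (T a) (T x) < \<epsilon>" .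
  qed
  then have "continuous_map (ntopology X) (ntopology Y) T"
    unfolding ntopology_def using into
    by (subst MX.metric_continuous_map[OF Metric_space_ndist[OF Y]]) auto
  then show ?thesis using into add scale by (auto simp: operators_def)
qed

text \<open>A continuous linear map sends some ball of radius \<open>\<delta>\<close> into the unit ball; rescaling an arbitrary
  vector to norm \<open>\<delta> / 2\<close> bounds the map. Boundedness is what all later arguments use, and
  together with \<open>operatorsI\<close> it removes topology from the definition of an operator.\<close>

lemma operators_bounded:
  assumes X: "normed_space X" and Y: "normed_space Y" and T: "T \<in> operators X Y"
  obtains C where "C \<ge> 0" "\<And>x. x \<in> carr X \<Longrightarrow> nrm Y (T x) \<le> C * nrm X x"
proof -
  interpret MX: Metric_space "carr X" "ndist X" by (rule Metric_space_ndist[OF X])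
  note clX = normed_space_closed[OF X]
  have into: "\<And>x. x \<in> carr X \<Longrightarrow> T x \<in> carr Y"
    and scale: "\<And>c x. x \<in> carr X \<Longrightarrow> T (scal X c x) = scal Y c (T x)"
    and cont: "continuous_map (ntopology X) (ntopology Y) T"
    using T by (auto simp: operators_def)
  have T0: "T 0 = 0" by (rule operators_zero[OF X T])
  from cont have "\<forall>a\<in>carr X. \<forall>\<epsilon>>0. \<exists>\<delta>>0. \<forall>x. x \<in> carr X \<and> ndist X a x < \<delta> \<longrightarrow> ndist Y (T a) (T x) < \<epsilon>"
    unfolding ntopology_def MX.metric_continuous_map[OF Metric_space_ndist[OF Y]] by blast
  then obtain \<delta> where \<delta>: "\<delta> > 0"
    "\<And>x. x \<in> carr X \<Longrightarrow> ndist X 0 x < \<delta> \<Longrightarrow> ndist Y (T 0) (T x) < 1"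
    using clX(1) zero_less_one by blast
  have small: "nrm Y (T x) < 1" if "x \<in> carr X" "nrm X x < \<delta>" for x
  proof -
    have "0 \<in> carr Y" using into[OF clX(1)] T0 by simp
    then show ?thesis
      using \<delta>(2)[OF that(1)] that into[OF that(1)] clX(1) T0
        nrm_minus[OF X that(1)] nrm_minus[OF Y into[OF that(1)]]
      by (simp add: ndist_def)
  qed
  show ?thesis
  proof (rule that[of "2 / \<delta>"])
    show "0 \<le> 2 / \<delta>" using \<delta> by simp
    fix x assume x: "x \<in> carr X"
    show "nrm Y (T x) \<le> 2 / \<delta> * nrm X x"
    proof (cases "x = 0")
      case True
      then show ?thesis
        using T0 normed_spaceD(3)[OF X clX(1)] normed_spaceD(3)[OF Y, of 0] into[OF clX(1)] by simp
    next
      case False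
      then have pos: "nrm X x > 0"
        using nrm_nonneg[OF X x] normed_spaceD(3)[OF X x] by simp
      define r where "r = \<delta> / (2 * nrm X x)"
      have r: "r > 0" using \<delta> pos by (simp add: r_def)
      have "nrm X (scal X (of_real r) x) = \<delta> / 2"
        using normed_spaceD(5)[OF X x, of "of_real r"] r pos \<delta>(1) by (simp add: r_def norm_divide norm_mult)
      then have "nrm Y (T (scal X (of_real r) x)) < 1"
        using small[OF clX(5)[OF x]] \<delta> by simp
      then have "r * nrm Y (T x) < 1"
        using scale[OF x] normed_spaceD(5)[OF Y into[OF x], of "of_real r"] r by simp
      then show ?thesis using \<delta> pos by (simp add: r_def field_simps)
    qed
  qed
qed

lemma scal_dual [simp]: "scal (dual X) = (\<lambda>c f x. c * f x)"
  by (simp add: dual_def)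

lemma nrm_dual: "nrm (dual X) f = (SUP x\<in>unit_ball X. norm (f x))"
  by (simp add: dual_def)

lemma dual_apply:
  assumes "f \<in> carr (dual X)"
  shows "\<And>x y. x \<in> carr X \<Longrightarrow> y \<in> carr X \<Longrightarrow> f (x + y) = f x + f y"
    and "\<And>c x. x \<in> carr X \<Longrightarrow> f (scal X c x) = c * f x"
    and "\<And>x. x \<notin> carr X \<Longrightarrow> f x = 0"
    and "f \<in> operators X scalar_space"
  using assms by (auto simp: dual_def operators_def)

lemma dualI:
  assumes "normed_space X"
    and "\<And>x y. x \<in> carr X \<Longrightarrow> y \<in> carr X \<Longrightarrow> f (x + y) = f x + f y"
    and "\<And>c x. x \<in> carr X \<Longrightarrow> f (scal X c x) = c * f x"
    and "\<And>x. x \<in> carr X \<Longrightarrow> norm (f x) \<le> C * nrm X x"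
    and "\<And>x. x \<notin> carr X \<Longrightarrow> f x = 0"
  shows "f \<in> carr (dual X)"
proof -
  have "f \<in> operators X scalar_space"
    by (rule operatorsI[where C = C]) (use assms normed_scalar_space in auto)
  then show ?thesis using assms by (simp add: dual_def)
qed

lemma zero_in_unit_ball: "normed_space X \<Longrightarrow> 0 \<in> unit_ball X"
  using normed_space_closed(1)[of X] normed_spaceD(3)[of X 0] by (simp add: unit_ball_def)

lemma bdd_above_dual:
  assumes X: "normed_space X" and f: "f \<in> carr (dual X)"
  shows "bdd_above ((\<lambda>x. norm (f x)) ` unit_ball X)"
proof -
  obtain C where C: "C \<ge> 0" "\<And>x. x \<in> carr X \<Longrightarrow> norm (f x) \<le> C * nrm X x"
    using operators_bounded[OF X normed_scalar_space dual_apply(4)[OF f]] by auto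
  show ?thesis
  proof (rule bdd_aboveI2)
    fix x assume "x \<in> unit_ball X"
    then show "norm (f x) \<le> C"
      using C(2)[of x] mult_left_mono[of "nrm X x" 1 C] C(1) by (auto simp: unit_ball_def)
  qed
qed

lemma nrm_dual_nonneg:
  assumes X: "normed_space X" and f: "f \<in> carr (dual X)"
  shows "0 \<le> nrm (dual X) f"
  unfolding nrm_dual
  by (rule cSUP_upper2[OF bdd_above_dual[OF assms] zero_in_unit_ball[OF X]]) simp

lemma norm_dual_le:
  assumes X: "normed_space X" and f: "f \<in> carr (dual X)" and x: "x \<in> carr X"
  shows "norm (f x) \<le> nrm (dual X) f * nrm X x"
proof (cases "x = 0")
  case True
  then show ?thesis
    using operators_zero[OF X dual_apply(4)[OF f]] normed_spaceD(3)[OF X x] by simp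
next
  case False
  then have pos: "nrm X x > 0"
    using nrm_nonneg[OF X x] normed_spaceD(3)[OF X x] by simp
  define u where "u = scal X (of_real (inverse (nrm X x))) x"
  have u: "u \<in> unit_ball X"
    using normed_spaceD(5)[OF X x, of "of_real (inverse (nrm X x))"] normed_space_closed(5)[OF X x] pos
    by (simp add: unit_ball_def u_def norm_inverse)
  have "norm (f x) / nrm X x = norm (f u)"
    using dual_apply(2)[OF f x] pos by (simp add: u_def norm_mult norm_inverse divide_inverse)
  also have "\<dots> \<le> nrm (dual X) f"
    unfolding nrm_dual by (rule cSUP_upper[OF u bdd_above_dual[OF X f]])
  finally show ?thesis using pos by (simp add: field_simps)
qed

lemma nrm_dual_leI:
  assumes X: "normed_space X" and "C \<ge> 0" "\<And>x. x \<in> carr X \<Longrightarrow> norm (f x) \<le> C * nrm X x"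
  shows "nrm (dual X) f \<le> C"
  unfolding nrm_dual
proof (rule cSUP_least)
  show "unit_ball X \<noteq> {}" using zero_in_unit_ball[OF X] by auto
  fix x assume "x \<in> unit_ball X"
  then show "norm (f x) \<le> C"
    using assms(3)[of x] mult_left_mono[of "nrm X x" 1 C] assms(2) by (auto simp: unit_ball_def)
qed

lemma unit_ball_dualD:
  assumes "normed_space X" "f \<in> unit_ball (dual X)" "x \<in> carr X"
  shows "norm (f x) \<le> nrm X x"
  using norm_dual_le[of X f x] mult_right_mono[of "nrm (dual X) f" 1 "nrm X x"] nrm_nonneg[of X x] assms
  by (simp add: unit_ball_def)

lemma unit_ball_dualI:
  assumes "normed_space X"
    and "\<And>x y. x \<in> carr X \<Longrightarrow> y \<in> carr X \<Longrightarrow> f (x + y) = f x + f y"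
    and "\<And>c x. x \<in> carr X \<Longrightarrow> f (scal X c x) = c * f x"
    and "\<And>x. x \<in> carr X \<Longrightarrow> norm (f x) \<le> nrm X x"
    and "\<And>x. x \<notin> carr X \<Longrightarrow> f x = 0"
  shows "f \<in> unit_ball (dual X)"
  using dualI[OF assms(1-3), where C = 1] nrm_dual_leI[OF assms(1), where f = f and C = 1] assms(4,5)
  by (simp add: unit_ball_def)

lemma normed_space_dual:
  fixes X :: "('k::real_normed_field, 'a::ab_group_add) nspace"
  assumes X: "normed_space X"
  shows "normed_space (dual X)"
proof -
  note cl = normed_space_closed[OF X]
  interpret D: vector_space "scal (dual X) :: 'k \<Rightarrow> ('a \<Rightarrow> 'k) \<Rightarrow> ('a \<Rightarrow> 'k)"
    by standard (simp_all add: fun_eq_iff algebra_simps)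
  have add: "f + g \<in> carr (dual X)"
      and tri: "nrm (dual X) (f + g) \<le> nrm (dual X) f + nrm (dual X) g"
    if f: "f \<in> carr (dual X)" and g: "g \<in> carr (dual X)" for f g
  proof -
    have b: "norm ((f + g) x) \<le> (nrm (dual X) f + nrm (dual X) g) * nrm X x" if "x \<in> carr X" for x
      using norm_dual_le[OF X f that] norm_dual_le[OF X g that] norm_triangle_ineq[of "f x" "g x"]
      by (simp add: algebra_simps)
    show "f + g \<in> carr (dual X)"
      using b by (rule dualI[OF X, rotated 2]) (auto simp: dual_apply[OF f] dual_apply[OF g] algebra_simps)
    show "nrm (dual X) (f + g) \<le> nrm (dual X) f + nrm (dual X) g"
      using nrm_dual_nonneg[OF X f] nrm_dual_nonneg[OF X g] b by (intro nrm_dual_leI[OF X]) auto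
  qed
  have scale: "(\<lambda>x. c * f x) \<in> carr (dual X)"
      and scale_le: "nrm (dual X) (\<lambda>x. c * f x) = norm c * nrm (dual X) f"
    if f: "f \<in> carr (dual X)" for c f
  proof -
    note nn = nrm_dual_nonneg[OF X f]
    have b: "norm (c * f x) \<le> norm c * nrm (dual X) f * nrm X x" if "x \<in> carr X" for x
      using mult_left_mono[OF norm_dual_le[OF X f that], of "norm c"] by (simp add: norm_mult algebra_simps)
    show mem: "(\<lambda>x. c * f x) \<in> carr (dual X)"
      using b by (rule dualI[OF X, rotated 2]) (auto simp: dual_apply[OF f] algebra_simps)
    have le: "nrm (dual X) (\<lambda>x. c * f x) \<le> norm c * nrm (dual X) f"
      using b nn by (intro nrm_dual_leI[OF X]) auto
    show "nrm (dual X) (\<lambda>x. c * f x) = norm c * nrm (dual X) f"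
    proof (cases "c = 0")
      case True
      have "nrm (dual X) (\<lambda>x. c * f x) = (SUP x\<in>unit_ball X. 0)" using True by (simp add: nrm_dual)
      also have "\<dots> = 0" using zero_in_unit_ball[OF X] by (intro cSUP_const) auto
      finally show ?thesis using True by simp
    next
      case False
      have nn': "0 \<le> nrm (dual X) (\<lambda>x. c * f x) / norm c"
        using nrm_dual_nonneg[OF X mem] by simp
      have "nrm (dual X) f \<le> nrm (dual X) (\<lambda>x. c * f x) / norm c"
      proof (rule nrm_dual_leI[OF X nn'])
        fix x assume "x \<in> carr X"
        from norm_dual_le[OF X mem this]
        show "norm (f x) \<le> nrm (dual X) (\<lambda>x. c * f x) / norm c * nrm X x"
          using False by (simp add: norm_mult field_simps)
      qed
      then show ?thesis using le False by (simp add: field_simps)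
    qed
  qed
  have zero: "0 \<in> carr (dual X)"
    by (rule dualI[OF X, where C = 0]) auto
  have sub: "module.subspace (scal (dual X)) (carr (dual X))"
    unfolding D.subspace_def using zero add scale by auto
  have "f = 0" if f: "f \<in> carr (dual X)" and 0: "nrm (dual X) f = 0" for f
  proof (rule ext)
    fix x show "f x = 0 x"
      using norm_dual_le[OF X f, of x] 0 dual_apply(3)[OF f, of x] by (cases "x \<in> carr X") auto
  qed
  moreover have "nrm (dual X) 0 = 0"
    using scale_le[OF zero, of 0] by (simp add: zero_fun_def)
  ultimately have "\<forall>f\<in>carr (dual X). nrm (dual X) f = 0 \<longleftrightarrow> f = 0" by blast
  then show ?thesis
    unfolding normed_space_def using D.vector_space_axioms sub tri scale_le by auto
qed

section \<open>The Hahn--Banach theorem\<close>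

text \<open>The theorem is proved for a sublinear functional \<open>p\<close> on a real subspace without extending functionals
  from smaller subspaces. Zorn's lemma gives a minimal sublinear functional below \<open>p\<close>; minimality
  forces it to be linear. Stating homogeneity as an inequality for positive scalars suffices, since
  the reverse inequality is the same one for the inverse scalar.\<close>

definition sublinear_on :: "(real \<Rightarrow> 'a \<Rightarrow> 'a) \<Rightarrow> 'a::ab_group_add set \<Rightarrow> ('a \<Rightarrow> real) \<Rightarrow> bool" where
  "sublinear_on s V q \<longleftrightarrow>
     (\<forall>x\<in>V. \<forall>y\<in>V. q (x + y) \<le> q x + q y) \<and> (\<forall>r>0. \<forall>x\<in>V. q (s r x) \<le> r * q x)"

context
  fixes s :: "real \<Rightarrow> 'a::ab_group_add \<Rightarrow> 'a" and V :: "'a set"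
  assumes vs: "vector_space s" and sub: "module.subspace s V"
begin

interpretation vector_space s by (rule vs)

lemma sublinear_on_zero: "sublinear_on s V q \<Longrightarrow> q 0 = 0"
proof -
  assume q: "sublinear_on s V q"
  have z: "0 \<in> V" by (rule subspace_0[OF sub])
  have "q 0 \<le> 2 * q 0" "q 0 \<le> (1/2) * q 0"
    using q z unfolding sublinear_on_def by (metis scale_zero_right zero_less_numeral,
      metis scale_zero_right half_gt_zero zero_less_one)
  then show "q 0 = 0" by simp
qed

lemma sublinear_on_scale:
  assumes q: "sublinear_on s V q" and "r > 0" "x \<in> V"
  shows "q (s r x) = r * q x"
proof -
  have "q (s (1/r) (s r x)) \<le> (1/r) * q (s r x)"
    using q assms(2) subspace_scale[OF sub assms(3), of r]
    unfolding sublinear_on_def by (metis zero_less_divide_1_iff)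
  then have "r * q x \<le> q (s r x)" using assms(2) by (simp add: field_simps)
  moreover have "q (s r x) \<le> r * q x" using assms by (simp add: sublinear_on_def)
  ultimately show ?thesis by simp
qed

lemma sublinear_on_neg:
  assumes q: "sublinear_on s V q" and "x \<in> V"
  shows "- q (- x) \<le> q x"
proof -
  have "q (x + - x) \<le> q x + q (- x)"
    using q assms(2) subspace_neg[OF sub assms(2)] unfolding sublinear_on_def by blast
  then show ?thesis using sublinear_on_zero[OF q] by simp
qed

text \<open>Whenever \<open>q (- y)\<close> exceeds \<open>- q y\<close>, that is, whenever \<open>q\<close> fails to be linear along \<open>y\<close>, this
  construction yields a strictly smaller sublinear functional: \<open>q'\<close> is the largest one below \<open>q\<close> with
  \<open>q' (- y) \<le> - q y\<close>.\<close>

lemma sublinear_on_reduce: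
  assumes q: "sublinear_on s V q" and y: "y \<in> V"
  defines "q' \<equiv> \<lambda>x. if x \<in> V then INF t\<in>{0..}. q (x + s t y) - t * q y else 0"
  shows "sublinear_on s V q'" "\<And>x. x \<in> V \<Longrightarrow> q' x \<le> q x" "q' (- y) \<le> - q y"
proof -
  have ty: "s t y \<in> V" for t by (rule subspace_scale[OF sub y])
  have qty: "q (s t y) = t * q y" if "t \<ge> 0" for t
    using sublinear_on_scale[OF q _ y, of t] sublinear_on_zero[OF q] that by (cases "t = 0") auto
  have add: "q (x + z) \<le> q x + q z" if "x \<in> V" "z \<in> V" for x z
    using q that by (simp add: sublinear_on_def)
  have bdd: "bdd_below ((\<lambda>t. q (x + s t y) - t * q y) ` {0..})" if x: "x \<in> V" for x
  proof (rule bdd_belowI2)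
    fix t :: real assume "t \<in> {0..}"
    then show "- q (- x) \<le> q (x + s t y) - t * q y"
      using add[of "x + s t y" "- x"] qty[of t] subspace_add[OF sub x ty] subspace_neg[OF sub x]
      by (simp add: algebra_simps)
  qed
  have le: "q' x \<le> q (x + s t y) - t * q y" if "x \<in> V" "t \<ge> 0" for x t
    using cINF_lower[OF bdd, of x t] that by (simp add: q'_def)
  have ge: "c \<le> q' x" if "x \<in> V" "\<And>t. t \<ge> 0 \<Longrightarrow> c \<le> q (x + s t y) - t * q y" for x c
    using that by (auto simp: q'_def intro!: cINF_greatest)
  show "q' x \<le> q x" if "x \<in> V" for x
    using le[OF that, of 0] by simp
  show "q' (- y) \<le> - q y"
    using le[OF subspace_neg[OF sub y], of 1] sublinear_on_zero[OF q] by simp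
  have "q' (x + z) \<le> q' x + q' z" if x: "x \<in> V" and z: "z \<in> V" for x z
  proof -
    \<comment> \<open>Two nested infima: the bound is shown for all parameters and then taken to each infimum in turn.\<close>
    have "q' (x + z) - q' x \<le> q (z + s u y) - u * q y" if u: "u \<ge> 0" for u
    proof -
      have "q' (x + z) - (q (z + s u y) - u * q y) \<le> q (x + s t y) - t * q y" if t: "t \<ge> 0" for t
      proof -
        have "q' (x + z) \<le> q (x + z + s (t + u) y) - (t + u) * q y"
          using t u by (intro le subspace_add[OF sub x z]) simp
        also have "x + z + s (t + u) y = (x + s t y) + (z + s u y)"
          by (simp add: scale_left_distrib algebra_simps)
        also have "q \<dots> \<le> q (x + s t y) + q (z + s u y)"
          by (intro add subspace_add[OF sub] x z ty)
        finally show ?thesis by (simp add: algebra_simps)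
      qed
      then have "q' (x + z) - (q (z + s u y) - u * q y) \<le> q' x" by (rule ge[OF x])
      then show ?thesis by simp
    qed
    then have "q' (x + z) - q' x \<le> q' z" by (rule ge[OF z])
    then show ?thesis by simp
  qed
  moreover have "q' (s r x) \<le> r * q' x" if r: "r > 0" and x: "x \<in> V" for r x
  proof -
    have "q' (s r x) / r \<le> q (x + s t y) - t * q y" if t: "t \<ge> 0" for t
    proof -
      have "q' (s r x) \<le> q (s r x + s (r * t) y) - (r * t) * q y"
        using r t by (intro le subspace_scale[OF sub x]) simp
      also have "s r x + s (r * t) y = s r (x + s t y)" by (simp add: scale_right_distrib)
      also have "q \<dots> = r * q (x + s t y)"
        by (intro sublinear_on_scale[OF q r] subspace_add[OF sub] x ty)
      finally show ?thesis using r by (simp add: field_simps)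
    qed
    then have "q' (s r x) / r \<le> q' x" by (rule ge[OF x])
    then show ?thesis using r by (simp add: field_simps)
  qed
  ultimately show "sublinear_on s V q'" by (simp add: sublinear_on_def)
qed

text \<open>The pointwise infimum of a chain is again sublinear, and the bound \<open>- p (- x) \<le> q x\<close>, valid for every
  sublinear \<open>q \<le> p\<close>, keeps it finite. Functionals are set to zero off \<open>V\<close> so that the order is
  antisymmetric.\<close>

lemma minimal_sublinear_on:
  assumes p: "sublinear_on s V p"
  shows "\<exists>q. sublinear_on s V q \<and> (\<forall>x\<in>V. q x \<le> p x) \<and>
    (\<forall>q'. sublinear_on s V q' \<longrightarrow> (\<forall>x\<in>V. q' x \<le> q x) \<longrightarrow> (\<forall>x\<in>V. q' x = q x))"
proof -
  define A where "A = {q. sublinear_on s V q \<and> (\<forall>x\<in>V. q x \<le> p x) \<and> (\<forall>x. x \<notin> V \<longrightarrow> q x = 0)}"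
  define P where "P q q' \<longleftrightarrow> (\<forall>x\<in>V. q' x \<le> q x)" for q q' :: "'a \<Rightarrow> real"
  have low: "- p (- x) \<le> q x" if "q \<in> A" "x \<in> V" for q x
  proof -
    have "- q (- x) \<le> q x" "q (- x) \<le> p (- x)"
      using sublinear_on_neg[of q x] subspace_neg[OF sub that(2)] that by (auto simp: A_def)
    then show ?thesis by simp
  qed
  have restr: "(\<lambda>x. if x \<in> V then q x else 0) \<in> A"
    if "sublinear_on s V q" "\<And>x. x \<in> V \<Longrightarrow> q x \<le> p x" for q
    using that subspace_add[OF sub] subspace_scale[OF sub]
    by (auto simp: A_def sublinear_on_def)
  have "\<exists>m\<in>A. \<forall>a\<in>A. P m a \<longrightarrow> a = m"
  proof (rule predicate_Zorn)
    show "partial_order_on A (relation_of P A)"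
    proof (rule partial_order_on_relation_ofI)
      show "P a a" for a by (simp add: P_def)
      show "P a c" if "P a b" "P b c" for a b c
        using that unfolding P_def by (meson order_trans)
      show "a = b" if "a \<in> A" "b \<in> A" "P a b" "P b a" for a b
      proof (rule ext)
        fix x show "a x = b x"
          using that by (cases "x \<in> V") (auto simp: A_def P_def intro: antisym)
      qed
    qed
  next
    fix C assume C: "C \<in> Chains (relation_of P A)"
    have CA: "q \<in> A" if "q \<in> C" for q
      using C that by (auto simp: Chains_def relation_of_def)
    have tot: "P q q' \<or> P q' q" if "q \<in> C" "q' \<in> C" for q q'
      using C that by (auto simp: Chains_def relation_of_def)
    show "\<exists>u\<in>A. \<forall>a\<in>C. P a u"
    proof (cases "C = {}")
      case True
      then show ?thesis using restr[OF p] by auto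
    next
      case False
      define u where "u x = (if x \<in> V then INF q\<in>C. q x else 0)" for x
      have bdd: "bdd_below ((\<lambda>q. q x) ` C)" if "x \<in> V" for x
        using low[OF CA that] by (intro bdd_belowI2)
      have le: "u x \<le> q x" if "x \<in> V" "q \<in> C" for x q
        using cINF_lower[OF bdd[OF that(1)] that(2)] that(1) by (simp add: u_def)
      have ge: "c \<le> u x" if "x \<in> V" "\<And>q. q \<in> C \<Longrightarrow> c \<le> q x" for x c
        using that False by (auto simp: u_def intro!: cINF_greatest)
      have slC: "sublinear_on s V q" if "q \<in> C" for q using CA[OF that] by (simp add: A_def)
      have "u (x + y) \<le> u x + u y" if x: "x \<in> V" and y: "y \<in> V" for x y
      proof -
        have "u (x + y) - u x \<le> q y" if q: "q \<in> C" for q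
        proof -
          have "u (x + y) - q y \<le> q' x" if q': "q' \<in> C" for q'
          proof -
            \<comment> \<open>The smaller of the two chain members bounds both arguments.\<close>
            obtain m where m: "m \<in> C" "m x \<le> q' x" "m y \<le> q y"
              using tot[OF q q'] q q' x y unfolding P_def by blast
            have "u (x + y) \<le> m (x + y)" by (rule le[OF subspace_add[OF sub x y] m(1)])
            also have "\<dots> \<le> m x + m y" using slC[OF m(1)] x y by (simp add: sublinear_on_def)
            finally show ?thesis using m by simp
          qed
          then have "u (x + y) - q y \<le> u x" by (rule ge[OF x])
          then show ?thesis by simp
        qed
        then have "u (x + y) - u x \<le> u y" by (rule ge[OF y])
        then show ?thesis by simp
      qed
      moreover have "u (s r x) \<le> r * u x" if r: "r > 0" and x: "x \<in> V" for r x
      proof -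
        have "u (s r x) / r \<le> q x" if q: "q \<in> C" for q
          using le[OF subspace_scale[OF sub x] q, of r] sublinear_on_scale[OF slC[OF q] r x] r
          by (simp add: field_simps)
        then have "u (s r x) / r \<le> u x" by (rule ge[OF x])
        then show ?thesis using r by (simp add: field_simps)
      qed
      ultimately have "sublinear_on s V u" by (simp add: sublinear_on_def)
      moreover have "u x \<le> p x" if "x \<in> V" for x
      proof -
        obtain q where "q \<in> C" using False by auto
        then show ?thesis using le[OF that] CA[of q] that by (fastforce simp: A_def)
      qed
      ultimately have "u \<in> A" by (auto simp: A_def u_def)
      moreover have "\<forall>a\<in>C. P a u" using le by (simp add: P_def)
      ultimately show ?thesis by blast
    qed
  qed
  then obtain m where m: "m \<in> A" "\<And>a. a \<in> A \<Longrightarrow> P m a \<Longrightarrow> a = m" by blast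
  show ?thesis
  proof (intro exI conjI)
    show "sublinear_on s V m" "\<forall>x\<in>V. m x \<le> p x" using m(1) by (auto simp: A_def)
    show "\<forall>q'. sublinear_on s V q' \<longrightarrow> (\<forall>x\<in>V. q' x \<le> m x) \<longrightarrow> (\<forall>x\<in>V. q' x = m x)"
    proof (intro allI impI ballI)
      fix q' x assume q': "sublinear_on s V q'" "\<forall>x\<in>V. q' x \<le> m x" and x: "x \<in> V"
      have "q' x \<le> p x" if "x \<in> V" for x
        using q'(2) m(1) that by (fastforce simp: A_def)
      then have "(\<lambda>x. if x \<in> V then q' x else 0) = m"
        using q' by (intro m(2) restr) (auto simp: P_def)
      from fun_cong[OF this, of x] x show "q' x = m x" by simp
    qed
  qed
qed

text \<open>Reducing \<open>p\<close> along \<open>y\<close> before minimising pins down the value at \<open>y\<close>: the reduced functional is at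
  most \<open>- p y\<close> at \<open>- y\<close>, hence a linear functional below it is at least \<open>p y\<close> at \<open>y\<close>.\<close>

theorem hahn_banach_sublinear:
  assumes p: "sublinear_on s V p" and y: "y \<in> V"
  shows "\<exists>f. (\<forall>x\<in>V. \<forall>z\<in>V. f (x + z) = f x + f z) \<and> (\<forall>r. \<forall>x\<in>V. f (s r x) = r * f x) \<and>
    (\<forall>x\<in>V. f x \<le> p x) \<and> f y = p y"
proof -
  obtain p' where p': "sublinear_on s V p'" "\<And>x. x \<in> V \<Longrightarrow> p' x \<le> p x" "p' (- y) \<le> - p y"
    using sublinear_on_reduce[OF p y] by blast
  obtain f where f: "sublinear_on s V f" "\<forall>x\<in>V. f x \<le> p' x"
    and min: "\<forall>q'. sublinear_on s V q' \<longrightarrow> (\<forall>x\<in>V. q' x \<le> f x) \<longrightarrow> (\<forall>x\<in>V. q' x = f x)"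
    using minimal_sublinear_on[OF p'(1)] by blast
  have odd: "f (- x) = - f x" if x: "x \<in> V" for x
  proof -
    note r = sublinear_on_reduce[OF f(1) x]
    have "f (- x) \<le> - f x" using min[rule_format, OF r(1) _ subspace_neg[OF sub x]] r(2,3) by simp
    then show ?thesis using sublinear_on_neg[OF f(1) x] by simp
  qed
  have le: "f (x + z) \<le> f x + f z" if "x \<in> V" "z \<in> V" for x z
    using f(1) that by (simp add: sublinear_on_def)
  have add: "f (x + z) = f x + f z" if x: "x \<in> V" and z: "z \<in> V" for x z
    using le[OF x z] le[OF subspace_add[OF sub x z] subspace_neg[OF sub z]] odd[OF z] by simp
  have scale: "f (s r x) = r * f x" if x: "x \<in> V" for r x
  proof (cases r "0 :: real" rule: linorder_cases)
    case less
    have "f (s r x) = - f (s (- r) x)"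
      using odd[OF subspace_scale[OF sub x, of "- r"]] by (simp add: scale_minus_left)
    then show ?thesis using sublinear_on_scale[OF f(1) _ x, of "- r"] less by simp
  qed (use sublinear_on_zero[OF f(1)] sublinear_on_scale[OF f(1) _ x, of r] in auto)
  have "f y = p y"
    using bspec[OF f(2) subspace_neg[OF sub y]] bspec[OF f(2) y] p'(2)[OF y] p'(3) odd[OF y] by linarith
  moreover have "f x \<le> p x" if "x \<in> V" for x
    using f(2) p'(2)[OF that] that by fastforce
  ultimately show ?thesis using add scale by blast
qed

end

lemma norm_sublinear_on:
  fixes X :: "('k::real_normed_field, 'a::ab_group_add) nspace"
  assumes X: "normed_space X"
  defines "s \<equiv> \<lambda>r. scal X (of_real r)"
  shows "vector_space s" "module.subspace s (carr X)" "sublinear_on s (carr X) (nrm X)"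
proof -
  interpret vx: vector_space "scal X" using X by (rule normed_spaceD)
  show vs: "vector_space s"
    by standard (simp_all add: s_def vx.scale_right_distrib vx.scale_left_distrib)
  then interpret S: vector_space s .
  show "module.subspace s (carr X)"
    unfolding S.subspace_def using normed_space_closed[OF X] by (simp add: s_def)
  show "sublinear_on s (carr X) (nrm X)"
    using normed_spaceD(4,5)[OF X] by (simp add: sublinear_on_def s_def)
qed

lemma norming_functional_real:
  fixes X :: "(real, 'a::ab_group_add) nspace"
  assumes X: "normed_space X" and y: "y \<in> carr X"
  shows "\<exists>f\<in>unit_ball (dual X). norm (f y) = nrm X y"
proof -
  obtain f where f: "\<And>x z. x \<in> carr X \<Longrightarrow> z \<in> carr X \<Longrightarrow> f (x + z) = f x + f z"
    "\<And>r x. x \<in> carr X \<Longrightarrow> f (scal X r x) = r * f x"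
    "\<And>x. x \<in> carr X \<Longrightarrow> f x \<le> nrm X x" "f y = nrm X y"
    using hahn_banach_sublinear[OF norm_sublinear_on[OF X] y] unfolding of_real_eq_id id_apply by blast
  define g where "g x = (if x \<in> carr X then f x else 0)" for x
  interpret vx: vector_space "scal X" using X by (rule normed_spaceD)
  note cl = normed_space_closed[OF X]
  have "norm (f x) \<le> nrm X x" if x: "x \<in> carr X" for x
    using f(3)[OF x] f(3)[OF cl(4)[OF x]] f(2)[OF x, of "-1"] nrm_minus[OF X x] by simp
  then have "g \<in> unit_ball (dual X)"
    by (intro unit_ball_dualI[OF X]) (auto simp: g_def f cl)
  moreover have "norm (g y) = nrm X y"
    using y f(4) nrm_nonneg[OF X y] by (simp add: g_def)
  ultimately show ?thesis by blast
qed

text \<open>A complex functional is recovered from its real part \<open>f\<close> as \<open>f x - \<i> f (\<i> x)\<close>; rotating \<open>x\<close> so that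
  the value becomes non-negative transfers the bound on the real part to the modulus.\<close>

lemma norming_functional_complex:
  fixes X :: "(complex, 'a::ab_group_add) nspace"
  assumes X: "normed_space X" and y: "y \<in> carr X"
  shows "\<exists>f\<in>unit_ball (dual X). norm (f y) = nrm X y"
proof -
  obtain f where f: "\<And>x z. x \<in> carr X \<Longrightarrow> z \<in> carr X \<Longrightarrow> f (x + z) = f x + f z"
    "\<And>r x. x \<in> carr X \<Longrightarrow> f (scal X (of_real r) x) = r * f x"
    "\<And>x. x \<in> carr X \<Longrightarrow> f x \<le> nrm X x" "f y = nrm X y"
    using hahn_banach_sublinear[OF norm_sublinear_on[OF X] y] by blast
  interpret vx: vector_space "scal X" using X by (rule normed_spaceD)
  note cl = normed_space_closed[OF X]
  define g where "g x = (if x \<in> carr X then Complex (f x) (- f (scal X \<i> x)) else 0)" for x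
  have scale: "g (scal X c x) = c * g x" if x: "x \<in> carr X" for c x
  proof -
    have dec: "scal X c x = scal X (of_real (Re c)) x + scal X (of_real (Im c)) (scal X \<i> x)" for c
      using complex_eq[of c] by (metis vx.scale_left_distrib vx.scale_scale mult.commute)
    have fc: "f (scal X c x) = Re c * f x + Im c * f (scal X \<i> x)" for c
      using f(1)[OF cl(5)[OF x, of "of_real (Re c)"] cl(5)[OF cl(5)[OF x], of "of_real (Im c)" \<i>]]
        f(2)[OF x, of "Re c"] f(2)[OF cl(5)[OF x, of \<i>], of "Im c"]
      by (subst dec) (simp del: vx.scale_scale)
    show ?thesis
      using x fc[of c] fc[of "\<i> * c"] by (simp add: g_def cl complex_eq_iff algebra_simps)
  qed
  have bound: "norm (g x) \<le> nrm X x" if x: "x \<in> carr X" for x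
  proof (cases "g x = 0")
    case True
    then show ?thesis using nrm_nonneg[OF X x] by simp
  next
    case False
    define c where "c = cnj (g x) / of_real (norm (g x))"
    have nc: "norm c = 1" using False by (simp add: c_def norm_divide)
    have "g (scal X c x) = of_real (norm (g x))"
      using False complex_norm_square[of "g x"]
      by (simp add: scale[OF x] c_def field_simps power2_eq_square)
    then have "norm (g x) = f (scal X c x)"
      using cl(5)[OF x] by (simp add: g_def complex_eq_iff)
    also have "\<dots> \<le> nrm X (scal X c x)" by (rule f(3)[OF cl(5)[OF x]])
    also have "\<dots> = nrm X x" using normed_spaceD(5)[OF X x] nc by simp
    finally show ?thesis .
  qed
  have "g \<in> unit_ball (dual X)"
    by (rule unit_ball_dualI[OF X _ scale bound])
      (auto simp: g_def f cl vx.scale_right_distrib complex_eq_iff)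
  moreover have "norm (g y) = nrm X y"
  proof (rule antisym[OF bound[OF y]])
    have "nrm X y = Re (g y)" using y f(4) by (simp add: g_def)
    also have "\<dots> \<le> norm (g y)" by (rule complex_Re_le_cmod)
    finally show "nrm X y \<le> norm (g y)" .
  qed
  ultimately show ?thesis by blast
qed

section \<open>From the biadjoint to the operator\<close>

lemma null_sequence_squeeze:
  fixes f g :: "nat \<Rightarrow> real"
  assumes "g \<longlonglongrightarrow> 0" "\<And>n. 0 \<le> f n" "\<And>n. f n \<le> g n"
  shows "f \<longlonglongrightarrow> 0"
  by (rule Lim_null_comparison[OF _ assms(1)]) (simp add: assms(2,3))

text \<open>The value off the dual space is zero because elements of the bidual are normalised that way.\<close>

definition canonical :: "('k::real_normed_field, 'a::ab_group_add) nspace \<Rightarrow> 'a \<Rightarrow> ('a \<Rightarrow> 'k) \<Rightarrow> 'k" where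
  "canonical X x = (\<lambda>f. if f \<in> carr (dual X) then f x else 0)"

lemma adjoint_in_dual:
  assumes X: "normed_space X" and Z: "normed_space Z" and S: "S \<in> operators X Z"
    and f: "f \<in> carr (dual Z)"
  shows "adjoint_op X S f \<in> carr (dual X)"
proof -
  note cl = normed_space_closed[OF X]
  obtain C where C: "\<And>x. x \<in> carr X \<Longrightarrow> nrm Z (S x) \<le> C * nrm X x"
    using operators_bounded[OF X Z S] by blast
  have S': "S x \<in> carr Z" if "x \<in> carr X" for x
    using S that by (auto simp: operators_def)
  have "norm (f (S x)) \<le> nrm (dual Z) f * C * nrm X x" if "x \<in> carr X" for x
    using norm_dual_le[OF Z f S'[OF that]] mult_left_mono[OF C[OF that] nrm_dual_nonneg[OF Z f]]
    by (simp add: mult.assoc)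
  then show ?thesis
    using S by (intro dualI[OF X, where C = "nrm (dual Z) f * C"])
      (auto simp: adjoint_op_def cl operators_def dual_apply[OF f] S')
qed

lemma adjoint_in_unit_ball:
  assumes X: "normed_space X" and Z: "normed_space Z" and S: "S \<in> operators X Z"
    and le: "\<And>x. x \<in> carr X \<Longrightarrow> nrm Z (S x) \<le> nrm X x"
    and f: "f \<in> unit_ball (dual Z)"
  shows "adjoint_op X S f \<in> unit_ball (dual X)"
proof -
  have fd: "f \<in> carr (dual Z)" using f by (simp add: unit_ball_def)
  have "norm (adjoint_op X S f x) \<le> 1 * nrm X x" if "x \<in> carr X" for x
    using unit_ball_dualD[OF Z f, of "S x"] le[OF that] S that
    by (auto simp: adjoint_op_def operators_def)
  then have "nrm (dual X) (adjoint_op X S f) \<le> 1"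
    by (intro nrm_dual_leI[OF X]) auto
  then show ?thesis using adjoint_in_dual[OF X Z S fd] by (simp add: unit_ball_def)
qed

lemma norm_canonical_le:
  assumes "normed_space X" "x \<in> carr X" "f \<in> carr (dual X)"
  shows "norm (canonical X x f) \<le> nrm X x * nrm (dual X) f"
  using norm_dual_le[OF assms(1,3,2)] assms(3) by (simp add: canonical_def mult.commute)

lemma canonical_in_bidual:
  assumes X: "normed_space X" and x: "x \<in> carr X"
  shows "canonical X x \<in> carr (bidual X)"
  using normed_space_closed(2,5)[OF normed_space_dual[OF X]] norm_canonical_le[OF X x]
  by (intro dualI[OF normed_space_dual[OF X], where C = "nrm X x"]) (auto simp: canonical_def)

lemma nrm_canonical_le:
  assumes X: "normed_space X" and x: "x \<in> carr X"
  shows "nrm (bidual X) (canonical X x) \<le> nrm X x"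
  using norm_canonical_le[OF X x] nrm_nonneg[OF X x] by (intro nrm_dual_leI[OF normed_space_dual[OF X]])

lemma canonical_operator:
  assumes X: "normed_space X"
  shows "canonical X \<in> operators X (bidual X)"
  by (rule operatorsI[OF X, where C = 1])
    (use nrm_canonical_le[OF X] canonical_in_bidual[OF X] in
      \<open>auto simp: normed_space_dual X canonical_def dual_apply fun_eq_iff\<close>)

lemma biadjoint_canonical:
  assumes "normed_space X" "normed_space Y" "T \<in> operators X Y" "x \<in> carr X"
  shows "biadjoint_op X Y T (canonical X x) = canonical Y (T x)"
  using adjoint_in_dual[OF assms(1-3)] assms(4)
  by (auto simp: biadjoint_op_def canonical_def adjoint_op_def fun_eq_iff)

lemma weakly_summable_contraction:
  assumes X: "normed_space X" and Z: "normed_space Z" and S: "S \<in> operators X Z"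
    and le: "\<And>x. x \<in> carr X \<Longrightarrow> nrm Z (S x) \<le> nrm X x"
    and x: "weakly_summable p X x"
  shows "weakly_summable p Z (\<lambda>n. S (x n))"
proof -
  have xc: "x n \<in> carr X" for n using x by (simp add: weakly_summable_def)
  have ev: "f (S (x n)) = adjoint_op X S f (x n)" for f n using xc by (simp add: adjoint_op_def)
  note ball = adjoint_in_unit_ball[OF X Z S le]
  let ?h = "\<lambda>f. (\<Sum>n. norm (f (x n)) powr p) powr (1 / p)"
  have "bdd_above ((\<lambda>f. ?h (adjoint_op X S f)) ` unit_ball (dual Z))"
    by (rule bdd_above_mono[of "?h ` unit_ball (dual X)"]) (use x ball in \<open>auto simp: weakly_summable_def\<close>)
  then show ?thesis
    using x ball S xc unfolding weakly_summable_def ev by (auto simp: operators_def)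
qed

lemma weakly_null_operator:
  assumes X: "normed_space X" and Z: "normed_space Z" and S: "S \<in> operators X Z"
    and x: "weakly_null X x"
  shows "weakly_null Z (\<lambda>n. S (x n))"
proof -
  have xc: "x n \<in> carr X" for n using x by (simp add: weakly_null_def)
  have "(\<lambda>n. f (S (x n))) \<longlonglongrightarrow> 0" if "f \<in> carr (dual Z)" for f
    using x adjoint_in_dual[OF X Z S that] xc by (auto simp: weakly_null_def adjoint_op_def)
  then show ?thesis using S xc by (auto simp: weakly_null_def operators_def)
qed

lemma bdd_above_tails:
  assumes x: "weakly_summable p X x" and p: "p \<ge> 1"
  shows "bdd_above ((\<lambda>f. (\<Sum>n. norm (f (x (n + m))) powr p) powr (1 / p)) ` unit_ball (dual X))"
proof -
  let ?h = "\<lambda>f. (\<Sum>n. norm (f (x n)) powr p) powr (1 / p)"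
  obtain M where M: "\<And>f. f \<in> unit_ball (dual X) \<Longrightarrow> ?h f \<le> M"
    using x unfolding weakly_summable_def bdd_above_def by blast
  show ?thesis
  proof (rule bdd_aboveI2)
    fix f assume f: "f \<in> unit_ball (dual X)"
    then have s: "summable (\<lambda>n. norm (f (x n)) powr p)" using x by (simp add: weakly_summable_def)
    have "(\<Sum>n. norm (f (x (n + m))) powr p) \<le> (\<Sum>n. norm (f (x n)) powr p)"
      using suminf_minus_initial_segment[OF s, of m] by (simp add: sum_nonneg)
    then have "(\<Sum>n. norm (f (x (n + m))) powr p) powr (1 / p) \<le> ?h f"
      using p summable_ignore_initial_segment[OF s, of m] by (intro powr_mono2) (auto intro: suminf_nonneg)
    with M[OF f] show "(\<Sum>n. norm (f (x (n + m))) powr p) powr (1 / p) \<le> M" by simp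
  qed
qed

text \<open>Both suprema range over values attained at functionals, so if every functional in the ball over \<open>X\<close>
  takes the same values on \<open>x\<close> as some functional in the ball over \<open>Z\<close> does on \<open>z\<close>, the first
  supremum is over a smaller set.\<close>

lemma uncond_summable_reflect:
  fixes X :: "('k::real_normed_field, 'a::ab_group_add) nspace"
    and Z :: "('k, 'c::ab_group_add) nspace"
  assumes X: "normed_space X" and p: "p \<ge> 1"
    and z: "uncond_summable p Z z" and x: "\<And>n. x n \<in> carr X"
    and ext: "\<And>f. f \<in> unit_ball (dual X) \<Longrightarrow> \<exists>h\<in>unit_ball (dual Z). \<forall>n. h (z n) = f (x n)"
  shows "uncond_summable p X x"
proof -
  let ?F = "\<lambda>(f :: 'a \<Rightarrow> 'k) m. (\<Sum>n. norm (f (x (n + m))) powr p) powr (1 / p)"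
  let ?G = "\<lambda>(h :: 'c \<Rightarrow> 'k) m. (\<Sum>n. norm (h (z (n + m))) powr p) powr (1 / p)"
  have zw: "weakly_summable p Z z" using z by (simp add: uncond_summable_def)
  have s: "summable (\<lambda>n. norm (f (x n)) powr p)" if f: "f \<in> unit_ball (dual X)" for f
  proof -
    obtain h where "h \<in> unit_ball (dual Z)" "\<forall>n. h (z n) = f (x n)" using ext[OF f] by blast
    then show ?thesis using zw by (auto simp: weakly_summable_def)
  qed
  have sub: "(\<lambda>f. ?F f m) ` unit_ball (dual X) \<subseteq> (\<lambda>h. ?G h m) ` unit_ball (dual Z)" for m
  proof (rule image_subsetI)
    fix f assume f: "f \<in> unit_ball (dual X)"
    then obtain h where "h \<in> unit_ball (dual Z)" "\<forall>n. h (z n) = f (x n)" using ext[OF f] by blast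
    then show "?F f m \<in> (\<lambda>h. ?G h m) ` unit_ball (dual Z)"
      by (intro image_eqI[where x = h]) auto
  qed
  have bdd: "bdd_above ((\<lambda>h. ?G h m) ` unit_ball (dual Z))" for m
    by (rule bdd_above_tails[OF zw p])
  have xw: "weakly_summable p X x"
    unfolding weakly_summable_def using x s bdd_above_mono[OF bdd sub, of 0] by simp
  have ne: "unit_ball (dual X) \<noteq> {}"
    using zero_in_unit_ball[OF normed_space_dual[OF X]] by auto
  have le: "(SUP f\<in>unit_ball (dual X). ?F f m) \<le> (SUP h\<in>unit_ball (dual Z). ?G h m)" for m
    using ne by (intro cSup_subset_mono bdd sub) auto
  have nonneg: "0 \<le> (SUP f\<in>unit_ball (dual X). ?F f m)" for m
    by (rule cSUP_upper2[OF bdd_above_mono[OF bdd sub] zero_in_unit_ball[OF normed_space_dual[OF X]]]) simp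
  have "(\<lambda>m. SUP h\<in>unit_ball (dual Z). ?G h m) \<longlonglongrightarrow> 0"
    using z by (simp add: uncond_summable_def)
  then have "(\<lambda>m. SUP f\<in>unit_ball (dual X). ?F f m) \<longlonglongrightarrow> 0"
    by (rule null_sequence_squeeze[OF _ nonneg le])
  then show ?thesis using xw by (simp add: uncond_summable_def)
qed

text \<open>For finite \<open>p\<close> a functional \<open>f\<close> on \<open>Y\<close> is represented on the bidual by evaluation at \<open>f\<close>. For
  \<open>p = \<infinity>\<close> the norming functionals show that the canonical embedding does not shrink norms.\<close>

theorem uncond_converging_of_biadjoint:
  fixes X :: "('k::real_normed_field, 'a::ab_group_add) nspace"
    and Y :: "('k, 'b::ab_group_add) nspace"
  assumes X: "normed_space X" and Y: "normed_space Y" and T: "T \<in> operators X Y" and p: "1 \<le> p"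
    and norming: "\<And>y. y \<in> carr Y \<Longrightarrow> \<exists>f\<in>unit_ball (dual Y). norm (f y) = nrm Y y"
    and conv: "uncond_converging p (bidual X) (bidual Y) (biadjoint_op X Y T)"
  shows "uncond_converging p X Y T"
proof -
  note X'' = normed_space_dual[OF normed_space_dual[OF X]]
  note Y' = normed_space_dual[OF Y]
  have into: "T x \<in> carr Y" if "x \<in> carr X" for x using T that by (auto simp: operators_def)
  show ?thesis
  proof (cases "p = \<infinity>")
    case True
    have "norm_null Y (\<lambda>n. T (x n))" if x: "weakly_null X x" for x
    proof -
      have xc: "x n \<in> carr X" for n using x by (simp add: weakly_null_def)
      have "norm_null (bidual Y) (\<lambda>n. biadjoint_op X Y T (canonical X (x n)))"
        using conv weakly_null_operator[OF X X'' canonical_operator[OF X] x] True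
        by (simp add: uncond_converging_def)
      then have lim: "(\<lambda>n. nrm (bidual Y) (canonical Y (T (x n)))) \<longlonglongrightarrow> 0"
        by (simp add: biadjoint_canonical[OF X Y T xc] norm_null_def)
      have low: "nrm Y y \<le> nrm (bidual Y) (canonical Y y)" if y: "y \<in> carr Y" for y
      proof -
        obtain f where f: "f \<in> carr (dual Y)" "nrm (dual Y) f \<le> 1" "norm (f y) = nrm Y y"
          using norming[OF y] by (auto simp: unit_ball_def)
        have "nrm Y y = norm (canonical Y y f)" using f by (simp add: canonical_def)
        also have "\<dots> \<le> nrm (bidual Y) (canonical Y y) * nrm (dual Y) f"
          by (rule norm_dual_le[OF Y' canonical_in_bidual[OF Y y] f(1)])
        also have "\<dots> \<le> nrm (bidual Y) (canonical Y y) * 1"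
          by (rule mult_left_mono[OF f(2) nrm_dual_nonneg[OF Y' canonical_in_bidual[OF Y y]]])
        finally show ?thesis by simp
      qed
      have "(\<lambda>n. nrm Y (T (x n))) \<longlonglongrightarrow> 0"
        by (intro null_sequence_squeeze[OF lim] nrm_nonneg[OF Y] low into[OF xc])
      then show ?thesis using into[OF xc] by (simp add: norm_null_def)
    qed
    then show ?thesis using True by (simp add: uncond_converging_def)
  next
    case False
    with p have r: "real_of_ereal p \<ge> 1" by (cases p) auto
    have "uncond_summable (real_of_ereal p) Y (\<lambda>n. T (x n))"
      if x: "weakly_summable (real_of_ereal p) X x" for x
    proof -
      have xc: "x n \<in> carr X" for n using x by (simp add: weakly_summable_def)
      have "weakly_summable (real_of_ereal p) (bidual X) (\<lambda>n. canonical X (x n))"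
        by (rule weakly_summable_contraction[OF X X'' canonical_operator[OF X] nrm_canonical_le[OF X] x])
      then have "uncond_summable (real_of_ereal p) (bidual Y) (\<lambda>n. biadjoint_op X Y T (canonical X (x n)))"
        using conv False unfolding uncond_converging_def by (simp only: if_False)
      then have "uncond_summable (real_of_ereal p) (bidual Y) (\<lambda>n. canonical Y (T (x n)))"
        by (simp only: biadjoint_canonical[OF X Y T xc])
      then show ?thesis
      proof (rule uncond_summable_reflect[OF Y r _ into[OF xc]])
        fix f assume f: "f \<in> unit_ball (dual Y)"
        then have "canonical (dual Y) f \<in> unit_ball (dual (bidual Y))"
          using canonical_in_bidual[OF Y', of f] nrm_canonical_le[OF Y', of f]
          by (auto simp: unit_ball_def)
        moreover have "canonical (dual Y) f (canonical Y (T (x n))) = f (T (x n))" for n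
          using f canonical_in_bidual[OF Y into[OF xc]] by (auto simp: canonical_def unit_ball_def)
        ultimately show "\<exists>h\<in>unit_ball (dual (bidual Y)). \<forall>n. h (canonical Y (T (x n))) = f (T (x n))"
          by blast
      qed
    qed
    then show ?thesis using False by (simp add: uncond_converging_def)
  qed
qed

section \<open>The Schur property and unconditional summability\<close>

text \<open>The equality case of Hoelder's inequality: weights proportional to \<open>\<bar>t\<^sub>n\<bar>\<^bsup>p-1\<^esup>\<close>, with the conjugate phase of
  \<open>t\<^sub>n\<close>, form a unit vector for the conjugate exponent and pair with \<open>t\<close> to its \<open>p\<close>-norm. Treating both
  claims together through Young's inequality includes \<open>p = 1\<close>, where the conjugate exponent is infinite.\<close>

lemma lp_norming_coefficients:
  fixes t :: "'i \<Rightarrow> 'k::real_normed_field" and p :: real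
  assumes A: "finite A" and p: "p \<ge> 1"
  shows "\<exists>a. norm (\<Sum>n\<in>A. a n * t n) = (\<Sum>n\<in>A. norm (t n) powr p) powr (1 / p) \<and>
    (\<forall>u. norm (\<Sum>n\<in>A. a n * u n) \<le> (\<Sum>n\<in>A. norm (u n) powr p) powr (1 / p))"
proof -
  define S where "S = (\<Sum>n\<in>A. norm (t n) powr p)"
  show ?thesis
  proof (cases "S = 0")
    case True
    then show ?thesis by (intro exI[of _ "\<lambda>n. 0"]) (simp add: S_def)
  next
    case False
    have "S \<ge> 0" by (simp add: S_def sum_nonneg)
    with False have S: "S > 0" by simp
    \<comment> \<open>Where \<open>t n = 0\<close>, division by zero makes the coefficient zero.\<close>
    define a where "a n = of_real (norm (t n) powr p / S powr (1 - 1 / p)) / t n" for n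
    have at: "a n * t n = of_real (norm (t n) powr p / S powr (1 - 1 / p))" for n
      by (cases "t n = 0") (simp_all add: a_def)
    have "(\<Sum>n\<in>A. a n * t n) = of_real (S / S powr (1 - 1 / p))"
      unfolding at by (simp add: S_def sum_divide_distrib)
    also have "S / S powr (1 - 1 / p) = S powr (1 / p)"
      using S by (simp add: powr_diff)
    finally have 1: "norm (\<Sum>n\<in>A. a n * t n) = S powr (1 / p)" by simp
    have 2: "norm (\<Sum>n\<in>A. a n * u n) \<le> (\<Sum>n\<in>A. norm (u n) powr p) powr (1 / p)" for u
    proof -
      define U where "U = (\<Sum>n\<in>A. norm (u n) powr p)"
      have U0: "U \<ge> 0" by (simp add: U_def sum_nonneg)
      show ?thesis
      proof (cases "U = 0")
        case True
        then have "\<forall>n\<in>A. norm (u n) powr p = 0"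
          unfolding U_def using A by (subst (asm) sum_nonneg_eq_0_iff) auto
        then show ?thesis by simp
      next
        case False
        with U0 have U: "U > 0" by simp
        have young: "norm (a n * u n) \<le>
            U powr (1 / p) * ((1 - 1 / p) * (norm (t n) powr p / S) + (1 / p) * (norm (u n) powr p / U))" for n
        proof (cases "t n = 0 \<or> u n = 0")
          case True
          then show ?thesis using p S U by (auto simp: a_def)
        next
          case False
          then have pos: "norm (t n) powr p / S > 0" "norm (u n) powr p / U > 0" using S U by auto
          have "(norm (t n) powr p / S) powr (1 - 1 / p) * (norm (u n) powr p / U) powr (1 / p)
              \<le> (1 - 1 / p) * (norm (t n) powr p / S) + (1 / p) * (norm (u n) powr p / U)"
            using p pos by (intro Youngs_inequality_0) auto
          moreover have "(norm (t n) powr p) powr (1 - 1 / p) = norm (t n) powr p / norm (t n)"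
            using p False by (simp add: powr_powr powr_diff right_diff_distrib)
          moreover have "(norm (u n) powr p) powr (1 / p) = norm (u n)"
            using p False by (simp add: powr_powr)
          moreover have "norm (a n) = norm (t n) powr p / norm (t n) / S powr (1 - 1 / p)"
            by (simp add: a_def norm_divide norm_mult)
          ultimately have "norm (a n) * norm (u n) / U powr (1 / p)
              \<le> (1 - 1 / p) * (norm (t n) powr p / S) + (1 / p) * (norm (u n) powr p / U)"
            using S U by (simp add: powr_divide)
          then show ?thesis using U by (simp add: norm_mult pos_divide_le_eq mult.commute)
        qed
        have "norm (\<Sum>n\<in>A. a n * u n) \<le> (\<Sum>n\<in>A. norm (a n * u n))" by (rule norm_sum)
        also have "\<dots> \<le> (\<Sum>n\<in>A. U powr (1 / p) *
            ((1 - 1 / p) * (norm (t n) powr p / S) + (1 / p) * (norm (u n) powr p / U)))"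
          by (intro sum_mono young)
        also have "\<dots> = U powr (1 / p) * ((1 - 1 / p) * (S / S) + (1 / p) * (U / U))"
          by (simp only: sum_distrib_left[symmetric] sum.distrib sum_divide_distrib[symmetric]
              S_def[symmetric] U_def[symmetric])
        also have "\<dots> = U powr (1 / p)" using S U by simp
        finally show ?thesis by (simp add: U_def)
      qed
    qed
    from 1 2 show ?thesis unfolding S_def by blast
  qed
qed

lemma dual_linear_combination:
  assumes X: "normed_space X" and y: "\<And>i. y i \<in> carr X"
  shows "(\<Sum>i\<in>A. scal X (a i) (y i)) \<in> carr X"
    and "g \<in> carr (dual X) \<Longrightarrow> g (\<Sum>i\<in>A. scal X (a i) (y i)) = (\<Sum>i\<in>A. a i * g (y i))"
proof -
  note cl = normed_space_closed[OF X]
  show mem: "(\<Sum>i\<in>A. scal X (a i) (y i)) \<in> carr X" for A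
    by (induction A rule: infinite_finite_induct) (use cl y in auto)
  assume g: "g \<in> carr (dual X)"
  show "g (\<Sum>i\<in>A. scal X (a i) (y i)) = (\<Sum>i\<in>A. a i * g (y i))"
    using operators_zero[OF X dual_apply(4)[OF g]]
    by (induction A rule: infinite_finite_induct) (use dual_apply[OF g] mem cl y in auto)
qed

lemma dual_scale_into_unit_ball:
  assumes X: "normed_space X" and g: "g \<in> carr (dual X)"
  shows "\<exists>c>0. (\<lambda>x. of_real c * g x) \<in> unit_ball (dual X)"
proof -
  define c where "c = 1 / (1 + nrm (dual X) g)"
  have c: "c > 0" "c * nrm (dual X) g \<le> 1"
    using nrm_dual_nonneg[OF X g] by (simp_all add: c_def field_simps)
  have "(\<lambda>x. of_real c * g x) \<in> unit_ball (dual X)"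
    using normed_space_closed(5)[OF normed_space_dual[OF X] g, of "of_real c"]
      normed_spaceD(5)[OF normed_space_dual[OF X] g, of "of_real c"] c
    by (simp add: unit_ball_def)
  with c show ?thesis by blast
qed

lemma weakly_summable_dual:
  assumes X: "normed_space X" and x: "weakly_summable p X x" and g: "g \<in> carr (dual X)"
  shows "summable (\<lambda>n. norm (g (x n)) powr p)"
proof -
  obtain c where c: "c > 0" "(\<lambda>x. of_real c * g x) \<in> unit_ball (dual X)"
    using dual_scale_into_unit_ball[OF X g] by blast
  have "\<forall>f\<in>unit_ball (dual X). summable (\<lambda>n. norm (f (x n)) powr p)"
    using x by (simp add: weakly_summable_def)
  from bspec[OF this c(2)] have "summable (\<lambda>n. norm (of_real c * g (x n)) powr p)" .
  then have "summable (\<lambda>n. c powr p * norm (g (x n)) powr p)"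
    using c by (simp add: norm_mult powr_mult)
  then show ?thesis using c by (simp add: summable_cmult_iff)
qed

text \<open>If the tail suprema stayed above \<open>e\<close>, then for every \<open>N\<close> some functional \<open>f\<close> in the dual ball would
  see more than \<open>e / 2\<close> of the \<open>p\<close>-norm of a finite block of \<open>x\<close> beyond \<open>N\<close>. Combining that block with the norming
  coefficients of \<open>f\<close> gives a vector \<open>z\<^sub>N\<close> of norm above \<open>e / 2\<close>, while the value of any functional
  \<open>g\<close> there is at most the \<open>p\<close>-th root of the \<open>N\<close>-th tail of the convergent series \<open>\<Sum> \<bar>g x\<^sub>n\<bar>\<^sup>p\<close>. So \<open>z\<close> is weakly null but not norm null.\<close>

theorem schur_imp_uncond_summable:
  fixes X :: "('k::real_normed_field, 'a::ab_group_add) nspace"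
  assumes X: "normed_space X" and schur: "\<And>z. weakly_null X z \<Longrightarrow> norm_null X z"
    and p: "p \<ge> 1" and x: "weakly_summable p X x"
  shows "uncond_summable p X x"
proof -
  let ?B = "unit_ball (dual X)"
  let ?F = "\<lambda>f m. (\<Sum>n. norm (f (x (n + m))) powr p) powr (1 / p)"
  define \<sigma> where "\<sigma> m = (SUP f\<in>?B. ?F f m)" for m
  have xc: "x n \<in> carr X" for n using x by (simp add: weakly_summable_def)
  note bdd = bdd_above_tails[OF x p]
  note zero = zero_in_unit_ball[OF normed_space_dual[OF X]]
  have \<sigma>0: "0 \<le> \<sigma> m" for m
    unfolding \<sigma>_def by (rule cSUP_upper2[OF bdd zero]) simp
  have "\<exists>N. \<forall>m\<ge>N. \<sigma> m < e" if e: "e > 0" for e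
  proof (rule ccontr)
    assume "\<nexists>N. \<forall>m\<ge>N. \<sigma> m < e"
    then have large: "\<exists>m\<ge>N. e \<le> \<sigma> m" for N by (meson not_less)
    have "\<exists>z f. z \<in> carr X \<and> f \<in> ?B \<and> e / 2 < norm (f z) \<and>
        (\<forall>g\<in>carr (dual X). norm (g z) \<le> ?F g N)" for N
    proof -
      obtain m where m: "m \<ge> N" "e \<le> \<sigma> m" using large by blast
      then have "e / 2 < (SUP f\<in>?B. ?F f m)" using e by (simp add: \<sigma>_def)
      then obtain f where f: "f \<in> ?B" "e / 2 < ?F f m"
        using less_cSUP_iff[OF _ bdd] zero by blast
      have fd: "f \<in> carr (dual X)" using f(1) by (simp add: unit_ball_def)
      have s: "summable (\<lambda>n. norm (g (x n)) powr p)" if "g \<in> carr (dual X)" for g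
        by (rule weakly_summable_dual[OF X x that])
      have sm: "summable (\<lambda>n. norm (g (x (n + m))) powr p)" if "g \<in> carr (dual X)" for g m
        by (rule summable_ignore_initial_segment[OF s[OF that]])
      have "(\<lambda>K. (\<Sum>n<K. norm (f (x (n + m))) powr p) powr (1 / p)) \<longlonglongrightarrow> ?F f m"
        using p by (intro tendsto_powr' summable_LIMSEQ sm fd) (auto intro!: always_eventually sum_nonneg)
      then have "eventually (\<lambda>K. e / 2 < (\<Sum>n<K. norm (f (x (n + m))) powr p) powr (1 / p)) sequentially"
        using f(2) by (rule order_tendstoD)
      then obtain K where K: "e / 2 < (\<Sum>n<K. norm (f (x (n + m))) powr p) powr (1 / p)"
        by (auto simp: eventually_sequentially)
      obtain a where a1: "norm (\<Sum>n<K. a n * f (x (n + m))) = (\<Sum>n<K. norm (f (x (n + m))) powr p) powr (1 / p)"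
        and a2: "\<And>u. norm (\<Sum>n<K. a n * u n) \<le> (\<Sum>n<K. norm (u n) powr p) powr (1 / p)"
        using lp_norming_coefficients[OF finite_lessThan[of K] p, of "\<lambda>n. f (x (n + m))"] by blast
      define z where "z = (\<Sum>n<K. scal X (a n) (x (n + m)))"
      have gz: "g z = (\<Sum>n<K. a n * g (x (n + m)))" if "g \<in> carr (dual X)" for g
        unfolding z_def by (rule dual_linear_combination(2)[OF X xc that])
      have "norm (g z) \<le> ?F g N" if g: "g \<in> carr (dual X)" for g
      proof -
        let ?h = "\<lambda>n. norm (g (x n)) powr p"
        have "(\<Sum>n<K. ?h (n + m)) \<le> (\<Sum>n. ?h (n + m))"
          by (rule sum_le_suminf[OF sm[OF g]]) auto
        also have "\<dots> = suminf ?h - sum ?h {..<m}" by (rule suminf_minus_initial_segment[OF s[OF g]])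
        also have "\<dots> \<le> suminf ?h - sum ?h {..<N}"
          using m(1) by (intro diff_left_mono sum_mono2) auto
        also have "\<dots> = (\<Sum>n. ?h (n + N))"
          by (rule suminf_minus_initial_segment[OF s[OF g], symmetric])
        finally have "(\<Sum>n<K. ?h (n + m)) powr (1 / p) \<le> ?F g N"
          using p by (intro powr_mono2) (auto intro: sum_nonneg)
        then show ?thesis unfolding gz[OF g] using a2[of "\<lambda>n. g (x (n + m))"] by simp
      qed
      moreover have "z \<in> carr X" unfolding z_def by (rule dual_linear_combination(1)[OF X xc])
      moreover have "e / 2 < norm (f z)" unfolding gz[OF fd] a1 by (rule K)
      ultimately show ?thesis using f(1) by blast
    qed
    then obtain z f where z: "\<And>N. z N \<in> carr X" "\<And>N. f N \<in> ?B" "\<And>N. e / 2 < norm (f N (z N))"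
      "\<And>N g. g \<in> carr (dual X) \<Longrightarrow> norm (g (z N)) \<le> ?F g N"
      by metis
    have "(\<lambda>N. g (z N)) \<longlonglongrightarrow> 0" if g: "g \<in> carr (dual X)" for g
    proof -
      let ?h = "\<lambda>n. norm (g (x n)) powr p"
      have s: "summable ?h" by (rule weakly_summable_dual[OF X x g])
      have "(\<lambda>N. suminf ?h - sum ?h {..<N}) \<longlonglongrightarrow> suminf ?h - suminf ?h"
        by (intro tendsto_intros summable_LIMSEQ s)
      then have "(\<lambda>N. \<Sum>n. ?h (n + N)) \<longlonglongrightarrow> 0"
        by (simp add: suminf_minus_initial_segment[OF s])
      then have "(\<lambda>N. ?F g N) \<longlonglongrightarrow> 0 powr (1 / p)"
        using p by (intro tendsto_powr')
          (auto intro!: always_eventually suminf_nonneg summable_ignore_initial_segment[OF s])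
      then have lim: "(\<lambda>N. ?F g N) \<longlonglongrightarrow> 0" by simp
      show ?thesis
        by (rule Lim_null_comparison[OF always_eventually lim]) (use z(4)[OF g] in blast)
    qed
    then have "norm_null X z" using z(1) by (intro schur) (simp add: weakly_null_def)
    then have "(\<lambda>N. nrm X (z N)) \<longlonglongrightarrow> 0" by (simp add: norm_null_def)
    moreover have "e / 2 \<le> nrm X (z N)" for N
      using z(3)[of N] unit_ball_dualD[OF X z(2)[of N] z(1)[of N]] by simp
    ultimately have "e / 2 \<le> 0" by (intro tendsto_lowerbound[where F = sequentially]) auto
    with e show False by simp
  qed
  then have "\<sigma> \<longlonglongrightarrow> 0" using \<sigma>0 by (auto simp: LIMSEQ_def dist_real_def abs_of_nonneg)
  then show ?thesis using x by (simp add: uncond_summable_def \<sigma>_def[abs_def])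
qed

lemma schur_id_uncond_converging:
  assumes X: "normed_space X" and schur: "\<And>z. weakly_null X z \<Longrightarrow> norm_null X z" and p: "1 \<le> p"
  shows "uncond_converging p X X (\<lambda>x. x)"
proof (cases "p = \<infinity>")
  case True
  then show ?thesis using schur by (simp add: uncond_converging_def)
next
  case False
  with p have "real_of_ereal p \<ge> 1" by (cases p) auto
  then show ?thesis
    using False schur_imp_uncond_summable[OF X schur] by (simp add: uncond_converging_def)
qed

section \<open>Sequences with bounded signed sums\<close>

text \<open>Choosing the scalars \<open>a\<^sub>k\<close> to rotate each \<open>F z\<^sub>k\<close> to its modulus turns the bound on signed sums into
  \<open>\<Sum> \<bar>F z\<^sub>k\<bar> \<le> 1\<close> for all \<open>F\<close> in the dual ball. All terms are then at most one, so raising them to the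
  power \<open>p\<close> only decreases them.\<close>

lemma signs_weakly_summable:
  fixes Z :: "('k::real_normed_field, 'c::ab_group_add) nspace" and z :: "nat \<Rightarrow> 'c"
  assumes Z: "normed_space Z" and z: "\<And>k. z k \<in> carr Z"
    and bound: "\<And>a K. (\<And>k. norm (a k) \<le> 1) \<Longrightarrow> nrm Z (\<Sum>k<K. scal Z (a k) (z k)) \<le> 1"
  shows "p \<ge> 1 \<Longrightarrow> weakly_summable p Z z" and "weakly_null Z z"
proof -
  have partial: "(\<Sum>k<K. norm (F (z k))) \<le> 1" if F: "F \<in> unit_ball (dual Z)" for F K
  proof -
    define a where "a k = of_real (norm (F (z k))) / F (z k)" for k
    have a1: "norm (a k) \<le> 1" for k by (simp add: a_def norm_divide)
    have aF: "a k * F (z k) = of_real (norm (F (z k)))" for k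
      by (cases "F (z k) = 0") (simp_all add: a_def)
    have Fd: "F \<in> carr (dual Z)" using F by (simp add: unit_ball_def)
    have "(\<Sum>k<K. norm (F (z k))) = norm (of_real (\<Sum>k<K. norm (F (z k))) :: 'k)"
      by (simp only: norm_of_real abs_of_nonneg sum_nonneg norm_ge_zero)
    also have "\<dots> = norm (F (\<Sum>k<K. scal Z (a k) (z k)))"
      by (simp add: dual_linear_combination(2)[OF Z z Fd] aF)
    also have "\<dots> \<le> nrm Z (\<Sum>k<K. scal Z (a k) (z k))"
      by (rule unit_ball_dualD[OF Z F dual_linear_combination(1)[OF Z z]])
    also have "\<dots> \<le> 1" by (rule bound[OF a1])
    finally show ?thesis .
  qed
  have summ: "summable (\<lambda>k. norm (F (z k)))" if "F \<in> unit_ball (dual Z)" for F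
    by (rule summableI_nonneg_bounded[OF _ partial[OF that]]) simp
  have sum_le: "(\<Sum>k. norm (F (z k))) \<le> 1" if "F \<in> unit_ball (dual Z)" for F
    by (rule suminf_le_const[OF summ[OF that] partial[OF that]])
  show "weakly_null Z z"
    unfolding weakly_null_def
  proof (intro conjI allI ballI z)
    fix F assume F: "F \<in> carr (dual Z)"
    obtain c where c: "c > 0" "(\<lambda>x. of_real c * F x) \<in> unit_ball (dual Z)"
      using dual_scale_into_unit_ball[OF Z F] by blast
    from summable_LIMSEQ_zero[OF summ[OF c(2)]] have "(\<lambda>k. c * norm (F (z k))) \<longlonglongrightarrow> 0"
      using c(1) by (simp add: norm_mult)
    then have "(\<lambda>k. (1 / c) * (c * norm (F (z k)))) \<longlonglongrightarrow> (1 / c) * 0"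
      by (rule tendsto_mult_left)
    then show "(\<lambda>k. F (z k)) \<longlonglongrightarrow> 0" using c(1) by (simp add: tendsto_norm_zero_iff)
  qed
  assume p: "p \<ge> 1"
  have pw: "norm (F (z k)) powr p \<le> norm (F (z k))" if F: "F \<in> unit_ball (dual Z)" for F k
  proof -
    have "norm (F (z k)) \<le> 1"
      using sum_le_suminf[OF summ[OF F], of "{k}"] sum_le[OF F] by simp
    then show ?thesis using powr_mono'[of 1 p "norm (F (z k))"] p by simp
  qed
  have summp: "summable (\<lambda>k. norm (F (z k)) powr p)" if "F \<in> unit_ball (dual Z)" for F
    using pw[OF that] by (intro summable_comparison_test'[OF summ[OF that]]) simp
  have "(\<Sum>k. norm (F (z k)) powr p) powr (1 / p) \<le> 1" if F: "F \<in> unit_ball (dual Z)" for F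
  proof -
    have "(\<Sum>k. norm (F (z k)) powr p) \<le> 1"
      using suminf_le[OF pw[OF F] summp[OF F] summ[OF F]] sum_le[OF F] by simp
    then show ?thesis
      using p powr_mono2[of "1 / p" _ 1] suminf_nonneg[OF summp[OF F]] by simp
  qed
  then show "weakly_summable p Z z"
    unfolding weakly_summable_def using z summp by (intro conjI bdd_aboveI2) auto
qed

text \<open>Such a sequence behaves like the unit vectors of \<open>c\<^sub>0\<close>, and \<open>far\<close> keeps the first term of every tail
  from being small uniformly on the dual ball.\<close>

theorem not_uncond_converging_if_signs:
  fixes Z :: "('k::real_normed_field, 'c::ab_group_add) nspace" and z :: "nat \<Rightarrow> 'c"
  assumes Z: "normed_space Z" and z: "\<And>k. z k \<in> carr Z"
    and bound: "\<And>a K. (\<And>k. norm (a k) \<le> 1) \<Longrightarrow> nrm Z (\<Sum>k<K. scal Z (a k) (z k)) \<le> 1"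
    and far: "\<And>k. \<exists>F\<in>unit_ball (dual Z). 1 \<le> norm (F (z k))"
    and T: "\<And>k. T (z k) = z k" and p: "1 \<le> p"
  shows "\<not> uncond_converging p Z Z T"
proof (cases "p = \<infinity>")
  case True
  have "1 \<le> nrm Z (z k)" for k
    using far[of k] unit_ball_dualD[OF Z _ z[of k]] by fastforce
  then have "\<not> norm_null Z z"
    using LIMSEQ_le_const[of "\<lambda>k. nrm Z (z k)" 0 1] by (auto simp: norm_null_def)
  then show ?thesis
    using True signs_weakly_summable(2)[OF Z z bound] by (auto simp: uncond_converging_def T)
next
  case False
  with p have r: "real_of_ereal p \<ge> 1" by (cases p) auto
  let ?p = "real_of_ereal p"
  have zw: "weakly_summable ?p Z z" by (rule signs_weakly_summable(1)[OF Z z bound r])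
  have "1 \<le> (SUP F\<in>unit_ball (dual Z). (\<Sum>n. norm (F (z (n + m))) powr ?p) powr (1 / ?p))" for m
  proof -
    obtain F where F: "F \<in> unit_ball (dual Z)" "1 \<le> norm (F (z m))" using far by blast
    have s: "summable (\<lambda>n. norm (F (z (n + m))) powr ?p)"
      using zw F(1) summable_ignore_initial_segment[where k = m and f = "\<lambda>n. norm (F (z n)) powr ?p"]
      by (simp add: weakly_summable_def)
    have "1 \<le> norm (F (z m)) powr ?p" using F(2) r by (intro ge_one_powr_ge_zero) auto
    also have "\<dots> \<le> (\<Sum>n. norm (F (z (n + m))) powr ?p)"
      using sum_le_suminf[OF s, of "{0}"] by simp
    finally have "1 \<le> (\<Sum>n. norm (F (z (n + m))) powr ?p) powr (1 / ?p)"
      using r by (intro ge_one_powr_ge_zero) auto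
    then show ?thesis
      by (intro cSUP_upper2[OF bdd_above_tails[OF zw r] F(1)])
  qed
  then have "\<not> uncond_summable ?p Z z"
    using LIMSEQ_le_const[where a = 1 and x = 0] by (fastforce simp: uncond_summable_def)
  then show ?thesis
    using False zw by (auto simp: uncond_converging_def T)
qed

section \<open>An \<open>l\<^sub>1\<close>-sum of finite-dimensional sup-norm spaces\<close>

text \<open>A sequence is read along the diagonals of \<open>\<nat> \<times> \<nat>\<close>: the \<open>d\<close>-th diagonal consists of the \<open>d + 1\<close> positions
  \<open>node k d\<close> with \<open>k \<le> d\<close> and carries the summand of dimension \<open>d + 1\<close>. Only \<open>k \<le> d\<close> is meaningful, as \<open>d - k\<close>
  is truncated subtraction.\<close>

abbreviation node :: "nat \<Rightarrow> nat \<Rightarrow> nat" where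
  "node k d \<equiv> prod_encode (k, d - k)"

definition diag_norm :: "nat \<Rightarrow> (nat \<Rightarrow> 'k::real_normed_field) \<Rightarrow> real" where
  "diag_norm d x = Max ((\<lambda>k. norm (x (node k d))) ` {..d})"

definition l1_linf :: "('k::{real_normed_field, banach}, nat \<Rightarrow> 'k) nspace" where
  "l1_linf = \<lparr>carr = {x. summable (\<lambda>d. diag_norm d x)},
              scal = (\<lambda>c x i. c * x i),
              nrm = (\<lambda>x. \<Sum>d. diag_norm d x)\<rparr>"

lemma l1_linf_simps:
  "x \<in> carr l1_linf \<longleftrightarrow> summable (\<lambda>d. diag_norm d x)"
  "scal l1_linf c x = (\<lambda>i. c * x i)"
  "nrm l1_linf x = (\<Sum>d. diag_norm d x)"
  by (simp_all add: l1_linf_def)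

lemma diag_norm_ge: "k \<le> d \<Longrightarrow> norm (x (node k d)) \<le> diag_norm d x"
  by (simp add: diag_norm_def)

lemma diag_norm_attained: "\<exists>k\<le>d. diag_norm d x = norm (x (node k d))"
proof -
  have "Max ((\<lambda>k. norm (x (node k d))) ` {..d}) \<in> (\<lambda>k. norm (x (node k d))) ` {..d}"
    by (intro Max_in) auto
  then obtain k where "k \<in> {..d}" "Max ((\<lambda>k. norm (x (node k d))) ` {..d}) = norm (x (node k d))"
    by (rule imageE)
  then show ?thesis by (intro exI[of _ k]) (simp add: diag_norm_def)
qed

lemma diag_norm_leI: "(\<And>k. k \<le> d \<Longrightarrow> norm (x (node k d)) \<le> C) \<Longrightarrow> diag_norm d x \<le> C"
  using diag_norm_attained[of d x] by auto

lemma diag_norm_nonneg: "0 \<le> diag_norm d x"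
  using diag_norm_attained[of d x] by auto

lemma diag_norm_add: "diag_norm d (x + y) \<le> diag_norm d x + diag_norm d y"
proof (rule diag_norm_leI)
  fix k assume "k \<le> d"
  then show "norm ((x + y) (node k d)) \<le> diag_norm d x + diag_norm d y"
    using norm_triangle_ineq[of "x (node k d)" "y (node k d)"] diag_norm_ge[of k d x] diag_norm_ge[of k d y]
    by simp
qed

lemma diag_norm_scale: "diag_norm d (\<lambda>i. c * x i) = norm c * diag_norm d x"
proof (rule antisym)
  show "diag_norm d (\<lambda>i. c * x i) \<le> norm c * diag_norm d x"
    by (rule diag_norm_leI) (simp add: norm_mult mult_left_mono diag_norm_ge)
  obtain k where "k \<le> d" "diag_norm d x = norm (x (node k d))" using diag_norm_attained by blast
  then show "norm c * diag_norm d x \<le> diag_norm d (\<lambda>i. c * x i)"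
    using diag_norm_ge[of k d "\<lambda>i. c * x i"] by (simp add: norm_mult)
qed

lemma diag_norm_le_sum: "diag_norm d x \<le> (\<Sum>k\<le>d. norm (x (node k d)))"
  by (rule diag_norm_leI) (rule member_le_sum, auto)

lemma node_cases:
  obtains k d where "i = node k d" "k \<le> d"
proof -
  obtain k m where "i = prod_encode (k, m)" by (metis prod_decode_inverse surj_pair)
  then show ?thesis using that[of k "k + m"] by simp
qed

lemma norm_le_l1_linf:
  assumes "x \<in> carr l1_linf"
  shows "norm (x i) \<le> nrm l1_linf x"
proof -
  obtain k d where i: "i = node k d" "k \<le> d" by (rule node_cases)
  have "diag_norm d x \<le> (\<Sum>d. diag_norm d x)"
    using sum_le_suminf[of "\<lambda>d. diag_norm d x" "{d}"] assms
    by (simp add: l1_linf_simps diag_norm_nonneg)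
  then show ?thesis using diag_norm_ge[OF i(2), of x] i by (simp add: l1_linf_simps)
qed

lemma normed_space_l1_linf:
  "normed_space (l1_linf :: ('k::{real_normed_field, banach}, nat \<Rightarrow> 'k) nspace)"
proof -
  let ?X = "l1_linf :: ('k, nat \<Rightarrow> 'k) nspace"
  interpret V: vector_space "scal ?X"
    by standard (simp_all add: fun_eq_iff l1_linf_simps algebra_simps)
  have zero: "diag_norm d (0 :: nat \<Rightarrow> 'k) = 0" for d
    using diag_norm_attained[of d "0 :: nat \<Rightarrow> 'k"] by auto
  have add: "x + y \<in> carr ?X" and tri: "nrm ?X (x + y) \<le> nrm ?X x + nrm ?X y"
    if "x \<in> carr ?X" "y \<in> carr ?X" for x y
  proof -
    have s: "summable (\<lambda>d. diag_norm d x + diag_norm d y)"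
      using that by (intro summable_add) (simp_all add: l1_linf_simps)
    show a: "x + y \<in> carr ?X"
      unfolding l1_linf_simps
      by (rule summable_comparison_test'[OF s]) (simp add: diag_norm_nonneg diag_norm_add)
    have "(\<Sum>d. diag_norm d (x + y)) \<le> (\<Sum>d. diag_norm d x + diag_norm d y)"
      by (rule suminf_le[OF diag_norm_add _ s]) (use a in \<open>simp add: l1_linf_simps\<close>)
    then show "nrm ?X (x + y) \<le> nrm ?X x + nrm ?X y"
      using that by (simp add: l1_linf_simps suminf_add)
  qed
  have "scal ?X c x \<in> carr ?X" "nrm ?X (scal ?X c x) = norm c * nrm ?X x" if "x \<in> carr ?X" for c x
    using that by (simp_all add: l1_linf_simps diag_norm_scale summable_mult suminf_mult)
  moreover have "nrm ?X x = 0 \<longleftrightarrow> x = 0" if x: "x \<in> carr ?X" for x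
  proof
    assume "nrm ?X x = 0"
    then show "x = 0" using norm_le_l1_linf[OF x] by (auto simp: fun_eq_iff)
  qed (simp add: l1_linf_simps zero)
  moreover have "module.subspace (scal ?X) (carr ?X)"
    unfolding V.subspace_def using add calculation(1) by (auto simp: l1_linf_simps(1) zero)
  ultimately show ?thesis
    unfolding normed_space_def using V.vector_space_axioms tri by blast
qed

text \<open>A Cauchy sequence converges in every coordinate. Since each diagonal is finite, this gives
  convergence in norm on any finite number of diagonals, and the Cauchy bound passes to the limit
  there; the bound is uniform in the number of diagonals.\<close>

theorem banach_space_l1_linf:
  "banach_space (l1_linf :: ('k::{real_normed_field, banach}, nat \<Rightarrow> 'k) nspace)"
proof -
  let ?X = "l1_linf :: ('k, nat \<Rightarrow> 'k) nspace"
  note X = normed_space_l1_linf[where 'k = 'k]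
  note cl = normed_space_closed[OF X]
  interpret M: Metric_space "carr ?X" "ndist ?X" by (rule Metric_space_ndist[OF X])
  have "\<exists>x. limitin M.mtopology \<sigma> x sequentially" if C: "M.MCauchy \<sigma>" for \<sigma>
  proof -
    have \<sigma>: "\<sigma> n \<in> carr ?X" for n using C by (auto simp: M.MCauchy_def)
    have cauchy: "\<exists>N. \<forall>n\<ge>N. \<forall>m\<ge>N. nrm ?X (\<sigma> n - \<sigma> m) < e" if "e > 0" for e
    proof -
      have "\<exists>N. \<forall>n n'. N \<le> n \<longrightarrow> N \<le> n' \<longrightarrow> ndist ?X (\<sigma> n) (\<sigma> n') < e"
        using C that by (simp add: M.MCauchy_def)
      then show ?thesis by (simp add: ndist_def \<sigma>)
    qed
    have "Cauchy (\<lambda>n. \<sigma> n i)" for i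
    proof (rule CauchyI)
      fix e :: real assume "e > 0"
      then obtain N where N: "\<forall>n\<ge>N. \<forall>m\<ge>N. nrm ?X (\<sigma> n - \<sigma> m) < e" using cauchy by blast
      have "norm (\<sigma> m i - \<sigma> n i) \<le> nrm ?X (\<sigma> m - \<sigma> n)" for m n
        using norm_le_l1_linf[OF cl(3)[OF \<sigma> \<sigma>], of m n i] by simp
      then show "\<exists>M. \<forall>m\<ge>M. \<forall>n\<ge>M. norm (\<sigma> m i - \<sigma> n i) < e"
        using N by (meson le_less_trans)
    qed
    then have "\<exists>l. (\<lambda>n. \<sigma> n i) \<longlonglongrightarrow> l" for i
      by (simp add: Cauchy_convergent_iff convergent_def)
    then obtain x where x: "\<And>i. (\<lambda>n. \<sigma> n i) \<longlonglongrightarrow> x i" by metis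
    have diag_lim: "(\<lambda>m. diag_norm d (\<sigma> m - x)) \<longlonglongrightarrow> 0" for d
    proof (rule null_sequence_squeeze[OF _ diag_norm_nonneg diag_norm_le_sum])
      have "(\<lambda>m. \<Sum>k\<le>d. norm (\<sigma> m (node k d) - x (node k d))) \<longlonglongrightarrow>
          (\<Sum>k\<le>d. norm (x (node k d) - x (node k d)))"
        by (intro tendsto_intros x)
      then show "(\<lambda>m. \<Sum>k\<le>d. norm ((\<sigma> m - x) (node k d))) \<longlonglongrightarrow> 0" by simp
    qed
    have partial: "(\<Sum>d<D. diag_norm d (\<sigma> n - x)) \<le> e"
      if N: "\<forall>n\<ge>N. \<forall>m\<ge>N. nrm ?X (\<sigma> n - \<sigma> m) < e" and n: "n \<ge> N" for N n e D
    proof -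
      have "(\<Sum>d<D. diag_norm d (\<sigma> n - x)) \<le> e + (\<Sum>d<D. diag_norm d (\<sigma> m - x))" if m: "m \<ge> N" for m
      proof -
        have "diag_norm d (\<sigma> n - x) \<le> diag_norm d (\<sigma> n - \<sigma> m) + diag_norm d (\<sigma> m - x)" for d
          using diag_norm_add[of d "\<sigma> n - \<sigma> m" "\<sigma> m - x"] by simp
        then have "(\<Sum>d<D. diag_norm d (\<sigma> n - x)) \<le>
            (\<Sum>d<D. diag_norm d (\<sigma> n - \<sigma> m)) + (\<Sum>d<D. diag_norm d (\<sigma> m - x))"
          by (simp add: sum.distrib[symmetric] sum_mono)
        moreover have "(\<Sum>d<D. diag_norm d (\<sigma> n - \<sigma> m)) \<le> nrm ?X (\<sigma> n - \<sigma> m)"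
          unfolding l1_linf_simps(3) using cl(3)[OF \<sigma> \<sigma>]
          by (intro sum_le_suminf) (simp_all add: l1_linf_simps diag_norm_nonneg)
        moreover have "nrm ?X (\<sigma> n - \<sigma> m) < e" using N n m by blast
        ultimately show ?thesis by linarith
      qed
      moreover have "(\<lambda>m. e + (\<Sum>d<D. diag_norm d (\<sigma> m - x))) \<longlonglongrightarrow> e + (\<Sum>d<D. 0)"
        by (intro tendsto_add tendsto_const tendsto_sum diag_lim)
      ultimately have "(\<Sum>d<D. diag_norm d (\<sigma> n - x)) \<le> e + (\<Sum>d<D. 0)"
        by (intro LIMSEQ_le_const) blast+
      then show ?thesis by simp
    qed
    have diff: "\<sigma> n - x \<in> carr ?X" "nrm ?X (\<sigma> n - x) \<le> e"
      if "\<forall>n\<ge>N. \<forall>m\<ge>N. nrm ?X (\<sigma> n - \<sigma> m) < e" "n \<ge> N" for N n e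
    proof -
      show s: "\<sigma> n - x \<in> carr ?X"
        unfolding l1_linf_simps by (rule summableI_nonneg_bounded[OF diag_norm_nonneg partial[OF that]])
      then show "nrm ?X (\<sigma> n - x) \<le> e"
        unfolding l1_linf_simps by (rule suminf_le_const[OF _ partial[OF that]])
    qed
    obtain N where "\<forall>n\<ge>N. \<forall>m\<ge>N. nrm ?X (\<sigma> n - \<sigma> m) < 1" using cauchy[of 1] by auto
    from cl(3)[OF \<sigma>[of N] diff(1)[OF this order_refl]] have xX: "x \<in> carr ?X" by simp
    have "\<forall>\<^sub>F n in sequentially. \<sigma> n \<in> carr ?X \<and> ndist ?X (\<sigma> n) x < e" if e: "e > 0" for e
    proof -
      obtain N where "\<forall>n\<ge>N. \<forall>m\<ge>N. nrm ?X (\<sigma> n - \<sigma> m) < e / 2" using cauchy[of "e / 2"] e by auto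
      from diff(2)[OF this] e have "nrm ?X (\<sigma> n - x) < e" if "n \<ge> N" for n
        using that by fastforce
      then show ?thesis using \<sigma> xX by (auto simp: eventually_sequentially ndist_def)
    qed
    then show ?thesis using xX by (auto simp: M.limitin_metric)
  qed
  then show ?thesis using X by (simp add: banach_space_def M.mcomplete_def)
qed

text \<open>Functionals that pick one position on each diagonal, with weights of modulus at most one. They lie
  in the dual ball, and they are all the functionals needed: the coordinate functionals, the one
  assembled in the gliding hump, and those detecting the elements of the bidual constructed below.\<close>

definition selector :: "(nat \<Rightarrow> nat) \<Rightarrow> (nat \<Rightarrow> 'k) \<Rightarrow> (nat \<Rightarrow> 'k) \<Rightarrow> 'k::{real_normed_field, banach}" where
  "selector \<kappa> w x = (if x \<in> carr l1_linf then \<Sum>d. w d * x (node (\<kappa> d) d) else 0)"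

lemma selector_sums:
  fixes w :: "nat \<Rightarrow> 'k::{real_normed_field, banach}"
  assumes \<kappa>: "\<And>d. \<kappa> d \<le> d" and w: "\<And>d. norm (w d) \<le> 1" and x: "x \<in> carr l1_linf"
  shows "norm (w d * x (node (\<kappa> d) d)) \<le> diag_norm d x"
    and "summable (\<lambda>d. norm (w d * x (node (\<kappa> d) d)))"
    and "(\<lambda>d. w d * x (node (\<kappa> d) d)) sums selector \<kappa> w x"
proof -
  show le: "norm (w d * x (node (\<kappa> d) d)) \<le> diag_norm d x" for d
    using mult_mono[OF w[of d] diag_norm_ge[OF \<kappa>[of d], of x]] by (simp add: norm_mult)
  show s: "summable (\<lambda>d. norm (w d * x (node (\<kappa> d) d)))"
    by (rule summable_comparison_test'[of "\<lambda>d. diag_norm d x" 0])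
      (use x le in \<open>simp_all add: l1_linf_simps\<close>)
  show "(\<lambda>d. w d * x (node (\<kappa> d) d)) sums selector \<kappa> w x"
    using summable_sums[OF summable_norm_cancel[OF s]] x by (simp add: selector_def)
qed

lemma selector_in_unit_ball:
  fixes w :: "nat \<Rightarrow> 'k::{real_normed_field, banach}"
  assumes \<kappa>: "\<And>d. \<kappa> d \<le> d" and w: "\<And>d. norm (w d) \<le> 1"
  shows "selector \<kappa> w \<in> unit_ball (dual l1_linf)"
proof (rule unit_ball_dualI[OF normed_space_l1_linf])
  let ?X = "l1_linf :: ('k, nat \<Rightarrow> 'k) nspace"
  note X = normed_space_l1_linf[where 'k = 'k]
  note sums = selector_sums(3)[of \<kappa> w, OF \<kappa> w]
  fix x y assume xy: "x \<in> carr ?X" "y \<in> carr ?X"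
  show "selector \<kappa> w (x + y) = selector \<kappa> w x + selector \<kappa> w y"
    using sums_unique2[OF sums[OF normed_space_closed(2)[OF X xy]]]
      sums_add[OF sums[OF xy(1)] sums[OF xy(2)]] by (simp add: ring_distribs)
next
  let ?X = "l1_linf :: ('k, nat \<Rightarrow> 'k) nspace"
  note X = normed_space_l1_linf[where 'k = 'k]
  note sums = selector_sums(3)[of \<kappa> w, OF \<kappa> w]
  fix c x assume x: "x \<in> carr ?X"
  show "selector \<kappa> w (scal ?X c x) = c * selector \<kappa> w x"
    using sums_unique2[OF sums[OF normed_space_closed(5)[OF X x, of c]]]
      sums_mult[OF sums[OF x], of c] by (simp add: l1_linf_simps(2) mult.left_commute)
next
  fix x :: "nat \<Rightarrow> 'k" assume x: "x \<in> carr l1_linf"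
  note s = selector_sums[of \<kappa> w x, OF \<kappa> w x]
  have "norm (selector \<kappa> w x) \<le> (\<Sum>d. norm (w d * x (node (\<kappa> d) d)))"
    using summable_norm[OF s(2)] sums_unique[OF s(3)] by simp
  also have "\<dots> \<le> nrm l1_linf x"
    using suminf_le[OF s(1,2)] x by (simp add: l1_linf_simps)
  finally show "norm (selector \<kappa> w x) \<le> nrm l1_linf x" .
qed (simp add: selector_def)

section \<open>A gliding hump and the Schur property\<close>

text \<open>The indices \<open>\<nu> i\<close> are chosen so that the mass of column \<open>\<nu> i\<close> sits, up to \<open>e / 4\<close>, on an interval of
  rows that is disjoint from the intervals of the other chosen columns; \<open>j\<close> assigns each row to its interval. The conclusion
  compares the mass of a column on its own rows with its mass on all others, which is the form in
  which a functional adapted to all the columns at once is estimated.\<close>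

lemma gliding_hump:
  fixes a :: "nat \<Rightarrow> nat \<Rightarrow> real"
  assumes nonneg: "\<And>d n. 0 \<le> a d n" and summ: "\<And>n. summable (\<lambda>d. a d n)"
    and null: "\<And>d. (\<lambda>n. a d n) \<longlonglongrightarrow> 0"
    and e: "e > 0" and large: "\<And>N. \<exists>n\<ge>N. e \<le> (\<Sum>d. a d n)"
  obtains \<nu> j :: "nat \<Rightarrow> nat" where "strict_mono \<nu>"
    "\<And>i. e / 2 \<le> (\<Sum>d. if j d = i then a d (\<nu> i) else - a d (\<nu> i))"
proof -
  define good where "good N D n E \<longleftrightarrow> N < n \<and> D < E \<and> e \<le> (\<Sum>d. a d n) \<and>
    (\<Sum>d<D. a d n) < e / 8 \<and> (\<Sum>d. a d n) - (\<Sum>d<E. a d n) < e / 8" for N D n E :: nat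
  have step: "\<exists>n E. good N D n E" for N D
  proof -
    have "(\<lambda>n. \<Sum>d<D. a d n) \<longlonglongrightarrow> (\<Sum>d<D. 0)" by (intro tendsto_sum null)
    then have "eventually (\<lambda>n. (\<Sum>d<D. a d n) < e / 8) sequentially"
      using e by (intro order_tendstoD(2)) auto
    then obtain M where M: "\<And>n. n \<ge> M \<Longrightarrow> (\<Sum>d<D. a d n) < e / 8"
      by (auto simp: eventually_sequentially)
    obtain n where n: "n \<ge> max M (Suc N)" "e \<le> (\<Sum>d. a d n)" using large by blast
    have "eventually (\<lambda>E. (\<Sum>d. a d n) - e / 8 < (\<Sum>d<E. a d n)) sequentially"
      using summable_LIMSEQ[OF summ] e by (intro order_tendstoD(1)) auto
    then obtain E where E: "\<And>m. m \<ge> E \<Longrightarrow> (\<Sum>d. a d n) - e / 8 < (\<Sum>d<m. a d n)"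
      by (auto simp: eventually_sequentially)
    have "good N D n (max E (Suc D))"
      unfolding good_def using n M[of n] E[of "max E (Suc D)"] by auto
    then show ?thesis by blast
  qed
  \<comment> \<open>Pairs of a column and the end of its interval. The first pair is a dummy that starts the intervals at row 0.\<close>
  have "\<exists>s :: nat \<Rightarrow> nat \<times> nat. \<forall>i. (i = 0 \<longrightarrow> snd (s i) = 0) \<and>
      good (fst (s i)) (snd (s i)) (fst (s (Suc i))) (snd (s (Suc i)))"
    using step by (intro dependent_nat_choice) auto
  then obtain s :: "nat \<Rightarrow> nat \<times> nat" where s0: "snd (s 0) = 0"
    and s: "\<And>i. good (fst (s i)) (snd (s i)) (fst (s (Suc i))) (snd (s (Suc i)))" by blast
  define \<nu> where "\<nu> i = fst (s (Suc i))" for i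
  define D where "D i = snd (s i)" for i
  define j where "j d = (LEAST i. d < D (Suc i))" for d
  have D: "strict_mono D" using s by (auto simp: strict_mono_Suc_iff D_def good_def)
  have j_iff: "j d = i \<longleftrightarrow> d \<in> {D i..<D (Suc i)}" for d i
  proof -
    have "d < D (Suc d)" using strict_mono_imp_increasing[OF D, of "Suc d"] by simp
    then have 1: "d < D (Suc (j d))" unfolding j_def by (rule LeastI)
    have 2: "D (j d) \<le> d"
    proof (cases "j d")
      case 0
      then show ?thesis using s0 by (simp add: D_def)
    next
      case (Suc m)
      then have "\<not> d < D (Suc m)" unfolding j_def by (intro not_less_Least) simp
      then show ?thesis using Suc by simp
    qed
    show ?thesis
    proof
      assume "d \<in> {D i..<D (Suc i)}"
      then have "D i < D (Suc (j d))" "D (j d) < D (Suc i)" using 1 2 by auto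
      then show "j d = i" using strict_mono_less[OF D] by simp
    qed (use 1 2 in auto)
  qed
  show ?thesis
  proof (rule that)
    show "strict_mono \<nu>" using s by (auto simp: strict_mono_Suc_iff \<nu>_def good_def)
    fix i
    let ?b = "\<lambda>d. a d (\<nu> i)"
    have "good (fst (s i)) (D i) (\<nu> i) (D (Suc i))" using s[of i] by (simp add: \<nu>_def D_def)
    then have g: "D i < D (Suc i)" "e \<le> suminf ?b" "sum ?b {..<D i} < e / 8"
        "suminf ?b - sum ?b {..<D (Suc i)} < e / 8"
      by (auto simp: good_def)
    \<comment> \<open>Own mass minus the rest is twice the own mass minus the total.\<close>
    have "(\<lambda>d. 2 * (if d \<in> {D i..<D (Suc i)} then ?b d else 0) - ?b d) sums
        (2 * sum ?b {D i..<D (Suc i)} - suminf ?b)"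
      by (intro sums_diff sums_mult sums_If_finite_set summable_sums summ) auto
    then have "(\<lambda>d. if j d = i then ?b d else - ?b d) sums (2 * sum ?b {D i..<D (Suc i)} - suminf ?b)"
      by (rule sums_cong[THEN iffD1, rotated]) (auto simp: j_iff)
    then have "(\<Sum>d. if j d = i then ?b d else - ?b d) = 2 * sum ?b {D i..<D (Suc i)} - suminf ?b"
      by (rule sums_unique[symmetric])
    moreover have "sum ?b {..<D (Suc i)} = sum ?b {..<D i} + sum ?b {D i..<D (Suc i)}"
      using g(1) by (metis sum.atLeastLessThan_concat lessThan_atLeast0 less_imp_le zero_le)
    ultimately show "e / 2 \<le> (\<Sum>d. if j d = i then ?b d else - ?b d)"
      using g by simp
  qed
qed

text \<open>If a weakly null sequence were not norm null, the gliding hump would apply to its diagonal norms: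
  coordinatewise convergence makes each row null because diagonals are finite. A selector that on each
  diagonal picks the largest entry of the vector owning that diagonal, with weight rotating it to its
  modulus, then stays at least \<open>e / 2\<close> along the subsequence.\<close>

theorem schur_property_l1_linf:
  fixes x :: "nat \<Rightarrow> nat \<Rightarrow> 'k::{real_normed_field, banach}"
  assumes x: "weakly_null l1_linf x"
  shows "norm_null l1_linf x"
proof (rule ccontr)
  assume not_null: "\<not> norm_null l1_linf x"
  have xc: "x n \<in> carr l1_linf" for n using x by (simp add: weakly_null_def)
  let ?a = "\<lambda>d n. diag_norm d (x n)"
  have sel: "(\<lambda>n. selector \<kappa> w (x n)) \<longlonglongrightarrow> 0"
    if "\<And>d. \<kappa> d \<le> d" "\<And>d. norm (w d) \<le> 1" for \<kappa> and w :: "nat \<Rightarrow> 'k"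
    using x selector_in_unit_ball[of \<kappa> w, OF that] by (simp add: weakly_null_def unit_ball_def)
  have coord: "(\<lambda>n. x n (node k d)) \<longlonglongrightarrow> 0" if k: "k \<le> d" for k d
  proof -
    \<comment> \<open>The minimum only keeps the position on the diagonal where the weight vanishes.\<close>
    let ?\<kappa> = "\<lambda>d'. min k d'" and ?w = "\<lambda>d'. if d' = d then 1 else 0 :: 'k"
    have "selector ?\<kappa> ?w (x n) = x n (node k d)" for n
    proof -
      have single: "(\<lambda>d'. if d' = d then x n (node k d') else 0) sums x n (node k d)"
        by (rule sums_single)
      have eq: "(\<lambda>d'. ?w d' * x n (node (?\<kappa> d') d')) = (\<lambda>d'. if d' = d then x n (node k d') else 0)"
        using k by (auto simp: min_absorb1)
      have "(\<lambda>d'. ?w d' * x n (node (?\<kappa> d') d')) sums selector ?\<kappa> ?w (x n)"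
        by (rule selector_sums(3)[OF _ _ xc]) auto
      from sums_unique2[OF this[unfolded eq] single] show ?thesis .
    qed
    then show ?thesis using sel[of ?\<kappa> ?w] by simp
  qed
  have null: "(\<lambda>n. ?a d n) \<longlonglongrightarrow> 0" for d
  proof (rule null_sequence_squeeze[OF _ diag_norm_nonneg diag_norm_le_sum])
    have "(\<lambda>n. \<Sum>k\<le>d. norm (x n (node k d))) \<longlonglongrightarrow> (\<Sum>k\<le>d. norm (0 :: 'k))"
      by (intro tendsto_sum tendsto_norm coord) simp
    then show "(\<lambda>n. \<Sum>k\<le>d. norm (x n (node k d))) \<longlonglongrightarrow> 0" by simp
  qed
  have summ: "summable (\<lambda>d. ?a d n)" for n using xc by (simp add: l1_linf_simps)
  have "\<not> (\<lambda>n. \<Sum>d. ?a d n) \<longlonglongrightarrow> 0"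
    using not_null xc by (simp add: norm_null_def l1_linf_simps)
  then obtain e where e: "e > 0" "\<And>N. \<exists>n\<ge>N. e \<le> (\<Sum>d. ?a d n)"
    unfolding LIMSEQ_def dist_real_def
    using suminf_nonneg[OF summ diag_norm_nonneg] by (auto simp: not_less) 
  obtain \<nu> j :: "nat \<Rightarrow> nat" where \<nu>: "strict_mono \<nu>"
    and hump: "\<And>i. e / 2 \<le> (\<Sum>d. if j d = i then ?a d (\<nu> i) else - ?a d (\<nu> i))"
    using gliding_hump[of ?a e] diag_norm_nonneg summ null e by blast
  \<comment> \<open>The vector that owns the \<open>d\<close>-th diagonal.\<close>
  define z where "z d = x (\<nu> (j d))" for d
  have "\<forall>d. \<exists>k\<le>d. diag_norm d (z d) = norm (z d (node k d))" using diag_norm_attained by blast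
  then obtain \<kappa> where \<kappa>: "\<And>d. \<kappa> d \<le> d" "\<And>d. diag_norm d (z d) = norm (z d (node (\<kappa> d) d))"
    by metis
  define w where "w d = of_real (norm (z d (node (\<kappa> d) d))) / z d (node (\<kappa> d) d)" for d
  have w: "norm (w d) \<le> 1" for d by (simp add: w_def norm_divide)
  have wz: "w d * z d (node (\<kappa> d) d) = of_real (diag_norm d (z d))" for d
    by (cases "z d (node (\<kappa> d) d) = 0") (simp_all add: w_def \<kappa>(2))
  have far: "e / 2 \<le> norm (selector \<kappa> w (x (\<nu> i)))" for i
  proof -
    let ?y = "x (\<nu> i)"
    let ?t = "\<lambda>d. w d * ?y (node (\<kappa> d) d)"
    \<comment> \<open>On its own diagonals the functional collects exactly \<open>b\<close>; elsewhere its terms are bounded by \<open>c\<close>.\<close>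
    let ?b = "\<lambda>d. if j d = i then diag_norm d ?y else 0"
    let ?c = "\<lambda>d. if j d = i then 0 else diag_norm d ?y"
    note t = selector_sums[of \<kappa> w ?y, OF \<kappa>(1) w xc]
    have sb: "summable ?b" and sc: "summable ?c"
      by (rule summable_comparison_test'[OF summ[of "\<nu> i"]]; simp add: diag_norm_nonneg)+
    have tb: "norm (?t d - of_real (?b d)) \<le> ?c d" for d
      using t(1)[of d] wz[of d] by (auto simp: z_def)
    have st: "summable (\<lambda>d. norm (?t d - of_real (?b d)))"
      by (rule summable_comparison_test'[OF sc]) (use tb in simp)
    have "norm (selector \<kappa> w ?y - of_real (suminf ?b)) = norm (\<Sum>d. ?t d - of_real (?b d))"
      using sums_unique[OF sums_diff[OF t(3) sums_of_real[OF summable_sums[OF sb]]]] by simp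
    also have "\<dots> \<le> (\<Sum>d. norm (?t d - of_real (?b d)))" by (rule summable_norm[OF st])
    also have "\<dots> \<le> suminf ?c" by (rule suminf_le[OF tb st sc])
    finally have "suminf ?b - suminf ?c \<le> norm (selector \<kappa> w ?y)"
      using norm_triangle_ineq2[of "of_real (suminf ?b) :: 'k" "of_real (suminf ?b) - selector \<kappa> w ?y"]
        suminf_nonneg[OF sb] diag_norm_nonneg by (simp add: norm_minus_commute)
    moreover have "suminf ?b - suminf ?c = (\<Sum>d. if j d = i then diag_norm d ?y else - diag_norm d ?y)"
      unfolding suminf_diff[OF sb sc] by (rule suminf_cong) simp
    ultimately show ?thesis using hump[of i] by simp
  qed
  have "(\<lambda>i. norm (selector \<kappa> w (x (\<nu> i)))) \<longlonglongrightarrow> 0"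
    using LIMSEQ_subseq_LIMSEQ[OF sel[OF \<kappa>(1) w] \<nu>] by (simp add: o_def tendsto_norm_zero)
  from LIMSEQ_le_const[OF this] far have "e / 2 \<le> 0" by blast
  with e(1) show False by simp
qed

section \<open>A generalized limit and the bidual\<close>

lemma bounded_range_mult:
  fixes a :: "nat \<Rightarrow> 'k::real_normed_field"
  assumes "bounded (range a)"
  shows "bounded (range (\<lambda>n. c * a n))"
proof -
  obtain B where "\<And>n. norm (a n) \<le> B" using assms by (auto simp: bounded_iff)
  then show ?thesis
    by (intro boundedI[where B = "norm c * B"]) (auto simp: norm_mult intro!: mult_left_mono)
qed

text \<open>The evaluations \<open>a \<mapsto> a n\<close> of bounded sequences live in a product of compact sets, so by Tychonoff's
  theorem they have a cluster point \<open>L\<close>. Every closed condition on a functional that the evaluations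
  eventually satisfy passes to \<open>L\<close>, and linearity, the norm bound and agreement with eventually constant
  sequences are continuous equations or inequalities in finitely many coordinates, hence closed. The
  argument treats real and complex scalars alike.\<close>

lemma generalized_limit:
  obtains L :: "(nat \<Rightarrow> 'k::{real_normed_field, heine_borel}) \<Rightarrow> 'k" where
    "\<And>a b. bounded (range a) \<Longrightarrow> bounded (range b) \<Longrightarrow> L (\<lambda>n. a n + b n) = L a + L b"
    "\<And>c a. bounded (range a) \<Longrightarrow> L (\<lambda>n. c * a n) = c * L a"
    "\<And>a C. (\<And>n. norm (a n) \<le> C) \<Longrightarrow> norm (L a) \<le> C"
    "\<And>a c. bounded (range a) \<Longrightarrow> eventually (\<lambda>n. a n = c) sequentially \<Longrightarrow> L a = c"
proof -
  \<comment> \<open>Unbounded sequences are sent to zero, so that every coordinate ranges over a compact set.\<close>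
  define ev :: "nat \<Rightarrow> (nat \<Rightarrow> 'k) \<Rightarrow> 'k" where "ev n a = (if bounded (range a) then a n else 0)" for n a
  define K :: "((nat \<Rightarrow> 'k) \<Rightarrow> 'k) set" where
    "K = PiE UNIV (\<lambda>a. if bounded (range a) then closure (range a) else {0})"
  have "compactin (product_topology (\<lambda>a :: nat \<Rightarrow> 'k. euclidean) UNIV) K"
    unfolding K_def by (subst compactin_PiE) auto
  then have "compact K"
    by (simp add: euclidean_product_topology)
  moreover have "eventually (\<lambda>l. l \<in> K) (filtermap ev sequentially)"
  proof -
    have "a n \<in> closure (range a)" for a :: "nat \<Rightarrow> 'k" and n
      using closure_subset by (rule subsetD) simp
    then have "ev n \<in> K" for n by (simp add: K_def ev_def PiE_UNIV_domain Pi_iff)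
    then show ?thesis by (simp add: eventually_filtermap)
  qed
  moreover have "filtermap ev sequentially \<noteq> bot" by (simp add: filtermap_bot_iff)
  ultimately obtain L where L: "inf (nhds L) (filtermap ev sequentially) \<noteq> bot"
    unfolding compact_filter by blast
  have closed: "L \<in> S" if "closed S" "eventually (\<lambda>n. ev n \<in> S) sequentially" for S
  proof (rule ccontr)
    assume "L \<notin> S"
    then have "eventually (\<lambda>l. l \<in> - S) (nhds L)"
      using that(1) by (intro eventually_nhds_in_open) auto
    moreover have "eventually (\<lambda>l. l \<in> S) (filtermap ev sequentially)"
      using that(2) by (simp add: eventually_filtermap)
    ultimately have "eventually (\<lambda>l. False) (inf (nhds L) (filtermap ev sequentially))"
      unfolding eventually_inf by (intro exI conjI) auto
    with L show False by (simp add: trivial_limit_def)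
  qed
  have cont [continuous_intros]: "continuous_on UNIV (\<lambda>l :: (nat \<Rightarrow> 'k) \<Rightarrow> 'k. l a)" for a
    by (rule continuous_on_product_coordinates)
  show ?thesis
  proof (rule that)
    fix a b :: "nat \<Rightarrow> 'k" assume ab: "bounded (range a)" "bounded (range b)"
    then have "bounded (range (\<lambda>n. a n + b n))" by (rule bounded_plus_comp)
    with ab have "L \<in> {l. l (\<lambda>n. a n + b n) = l a + l b}"
      by (intro closed closed_Collect_eq continuous_intros) (auto simp: ev_def)
    then show "L (\<lambda>n. a n + b n) = L a + L b" by simp
  next
    fix c :: 'k and a :: "nat \<Rightarrow> 'k" assume a: "bounded (range a)"
    then have "bounded (range (\<lambda>n. c * a n))" by (rule bounded_range_mult)
    with a have "L \<in> {l. l (\<lambda>n. c * a n) = c * l a}"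
      by (intro closed closed_Collect_eq continuous_intros) (auto simp: ev_def)
    then show "L (\<lambda>n. c * a n) = c * L a" by simp
  next
    fix a :: "nat \<Rightarrow> 'k" and C assume a: "\<And>n. norm (a n) \<le> C"
    then have "bounded (range a)" by (auto simp: bounded_iff)
    with a have "L \<in> {l. norm (l a) \<le> C}"
      by (intro closed closed_Collect_le continuous_intros) (auto simp: ev_def)
    then show "norm (L a) \<le> C" by simp
  next
    fix a :: "nat \<Rightarrow> 'k" and c assume a: "bounded (range a)" "eventually (\<lambda>n. a n = c) sequentially"
    then have "L \<in> {l. l a = c}"
      by (intro closed closed_Collect_eq continuous_intros) (auto simp: ev_def)
    then show "L a = c" by simp
  qed
qed

text \<open>Values \<open>y k\<close> with \<open>k > d\<close> do not occur on the \<open>d\<close>-th diagonal and are dropped, so the \<open>k\<close>-th unit vector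
  is zero on the diagonals that are too short to contain it.\<close>

definition diag_embed :: "nat \<Rightarrow> (nat \<Rightarrow> 'k::zero) \<Rightarrow> nat \<Rightarrow> 'k" where
  "diag_embed d y i = (case prod_decode i of (k, m) \<Rightarrow> if k + m = d then y k else 0)"

lemma diag_embed_node: "k \<le> d' \<Longrightarrow> diag_embed d y (node k d') = (if d' = d then y k else 0)"
  by (simp add: diag_embed_def)

lemma diag_embed_l1_linf:
  fixes y :: "nat \<Rightarrow> 'k::{real_normed_field, banach}"
  assumes y: "\<And>k. norm (y k) \<le> C"
  shows "diag_embed d y \<in> carr l1_linf" "nrm l1_linf (diag_embed d y) \<le> C"
proof -
  have C: "C \<ge> 0" using y[of 0] norm_ge_zero[of "y 0"] by linarith
  have le: "diag_norm d' (diag_embed d y) \<le> (if d' = d then C else 0)" for d'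
    by (rule diag_norm_leI) (auto simp: diag_embed_node y C)
  have s: "(\<lambda>d'. if d' = d then C else 0) sums C" by (rule sums_single)
  show 1: "diag_embed d y \<in> carr l1_linf"
    unfolding l1_linf_simps
    by (rule summable_comparison_test'[OF sums_summable[OF s]]) (simp add: diag_norm_nonneg le)
  show "nrm l1_linf (diag_embed d y) \<le> C"
    using suminf_le[OF le _ sums_summable[OF s]] 1 sums_unique[OF s] by (simp add: l1_linf_simps)
qed

abbreviation diag_unit :: "nat \<Rightarrow> nat \<Rightarrow> nat \<Rightarrow> 'k::{real_normed_field, banach}" where
  "diag_unit k d \<equiv> diag_embed d (\<lambda>k'. if k' = k then 1 else 0)"

lemma sum_diag_units:
  fixes a :: "nat \<Rightarrow> 'k::{real_normed_field, banach}"
  shows "(\<Sum>k<K. scal l1_linf (a k) (diag_unit k d)) = diag_embed d (\<lambda>k. if k < K then a k else 0)"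
  by (induction K) (auto simp: fun_eq_iff diag_embed_def l1_linf_simps split: prod.splits)

lemma diag_unit_in_ball:
  "diag_unit k d \<in> carr l1_linf" "nrm l1_linf (diag_unit k d :: nat \<Rightarrow> 'k::{real_normed_field, banach}) \<le> 1"
  by (rule diag_embed_l1_linf[where C = 1]; simp)+

text \<open>The elements \<open>\<phi>\<^sub>k\<close> of the bidual are generalized limits of unit vectors. A functional applied to a
  signed sum of unit vectors of one diagonal is bounded by the norm of the functional, because the sum lies in the unit
  ball of that summand; the generalized limit preserves this bound.\<close>

theorem bidual_l1_linf_not_uncond_converging:
  assumes p: "1 \<le> p"
  shows "\<not> uncond_converging p
    (bidual (l1_linf :: ('k::{real_normed_field, banach, heine_borel}, nat \<Rightarrow> 'k) nspace))
    (bidual l1_linf) (biadjoint_op l1_linf l1_linf (\<lambda>x. x))"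
proof -
  let ?X = "l1_linf :: ('k, nat \<Rightarrow> 'k) nspace"
  note X = normed_space_l1_linf[where 'k = 'k]
  note X' = normed_space_dual[OF X]
  obtain L :: "(nat \<Rightarrow> 'k) \<Rightarrow> 'k" where
    L_add: "\<And>a b. bounded (range a) \<Longrightarrow> bounded (range b) \<Longrightarrow> L (\<lambda>n. a n + b n) = L a + L b"
    and L_mult: "\<And>c a. bounded (range a) \<Longrightarrow> L (\<lambda>n. c * a n) = c * L a"
    and L_bound: "\<And>a C. (\<And>n. norm (a n) \<le> C) \<Longrightarrow> norm (L a) \<le> C"
    and L_lim: "\<And>a c. bounded (range a) \<Longrightarrow> eventually (\<lambda>n. a n = c) sequentially \<Longrightarrow> L a = c"
    using generalized_limit[where 'k = 'k] by blast
  have sum_L: "bounded (range (\<lambda>n. \<Sum>k<K. a k * h k n)) \<and>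
      L (\<lambda>n. \<Sum>k<K. a k * h k n) = (\<Sum>k<K. a k * L (h k))"
    if h: "\<And>k. bounded (range (h k))" for K and a :: "nat \<Rightarrow> 'k" and h
  proof (induction K)
    case 0
    have "bounded (range (\<lambda>n :: nat. 0 :: 'k))" by simp
    then show ?case using L_lim[of "\<lambda>n. 0" 0] by simp
  next
    case (Suc K)
    then show ?case
      using bounded_range_mult[OF h[of K], of "a K"] L_mult[OF h[of K], of "a K"]
      by (simp add: L_add bounded_plus_comp)
  qed
  define \<phi> where "\<phi> k = (\<lambda>g. if g \<in> carr (dual ?X) then L (\<lambda>d. g (diag_unit k d)) else 0)" for k
  have bound: "norm (g (diag_unit k d)) \<le> nrm (dual ?X) g" if g: "g \<in> carr (dual ?X)" for g k d
    using norm_dual_le[OF X g diag_unit_in_ball(1), of d k] nrm_dual_nonneg[OF X g]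
      mult_left_mono[OF diag_unit_in_ball(2)[of d k, where 'k = 'k], of "nrm (dual ?X) g"] by simp
  then have bdd: "bounded (range (\<lambda>d. g (diag_unit k d)))" if "g \<in> carr (dual ?X)" for g k
    using that by (intro boundedI) auto
  have \<phi>_ball: "\<phi> k \<in> unit_ball (bidual ?X)" for k
    by (rule unit_ball_dualI[OF X'])
      (use normed_space_closed(2,5)[OF X'] in \<open>simp_all add: \<phi>_def L_add L_mult bdd L_bound bound\<close>)
  then have \<phi>: "\<phi> k \<in> carr (bidual ?X)" for k by (simp add: unit_ball_def)
  have signs: "nrm (bidual ?X) (\<Sum>k<K. scal (bidual ?X) (a k) (\<phi> k)) \<le> 1"
    if a: "\<And>k. norm (a k) \<le> 1" for a K
  proof (rule nrm_dual_leI[OF X'])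
    fix g assume g: "g \<in> carr (dual ?X)"
    have "(\<Sum>k<K. scal (bidual ?X) (a k) (\<phi> k)) g = (\<Sum>k<K. a k * L (\<lambda>d. g (diag_unit k d)))"
      by (induction K) (simp_all add: \<phi>_def g)
    also have "\<dots> = L (\<lambda>d. \<Sum>k<K. a k * g (diag_unit k d))"
      using sum_L[where h = "\<lambda>k d. g (diag_unit k d)" and K = K and a = a, OF bdd[OF g]] by simp
    also have "norm \<dots> \<le> nrm (dual ?X) g"
    proof (rule L_bound)
      fix d
      let ?y = "diag_embed d (\<lambda>k. if k < K then a k else 0) :: nat \<Rightarrow> 'k"
      have y: "?y \<in> carr ?X" "nrm ?X ?y \<le> 1"
        by (rule diag_embed_l1_linf[where C = 1]; use a in simp)+
      have "(\<Sum>k<K. a k * g (diag_unit k d)) = g (\<Sum>k<K. scal ?X (a k) (diag_unit k d))"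
        by (rule dual_linear_combination(2)[OF X diag_unit_in_ball(1) g, symmetric])
      also have "\<dots> = g ?y" by (simp only: sum_diag_units)
      finally show "norm (\<Sum>k<K. a k * g (diag_unit k d)) \<le> nrm (dual ?X) g"
        using norm_dual_le[OF X g y(1)] mult_left_mono[OF y(2) nrm_dual_nonneg[OF X g]] by simp
    qed
    finally show "norm ((\<Sum>k<K. scal (bidual ?X) (a k) (\<phi> k)) g) \<le> 1 * nrm (dual ?X) g" by simp
  qed simp
  have far: "\<exists>F\<in>unit_ball (dual (bidual ?X)). 1 \<le> norm (F (\<phi> k))" for k
  proof -
    \<comment> \<open>The sum of the \<open>k\<close>-th coordinates; the finitely many diagonals with \<open>d < k\<close> are invisible to \<open>L\<close>.\<close>
    let ?g = "selector (\<lambda>d. min k d) (\<lambda>d. 1) :: (nat \<Rightarrow> 'k) \<Rightarrow> 'k"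
    have g: "?g \<in> unit_ball (dual ?X)" by (rule selector_in_unit_ball) auto
    then have gd: "?g \<in> carr (dual ?X)" by (simp add: unit_ball_def)
    have "?g (diag_unit k d) = 1" if k: "k \<le> d" for d
    proof -
      have "(\<lambda>d'. 1 * diag_unit k d (node (min k d') d')) sums ?g (diag_unit k d)"
        by (rule selector_sums(3)) (auto intro: diag_unit_in_ball)
      moreover have "(\<lambda>d'. 1 * diag_unit k d (node (min k d') d')) = (\<lambda>d'. if d' = d then 1 else 0 :: 'k)"
        using k by (auto simp: diag_embed_node min_absorb1 fun_eq_iff)
      moreover have "(\<lambda>d'. if d' = d then 1 else 0 :: 'k) sums 1" by (rule sums_single)
      ultimately show ?thesis by (simp add: sums_unique2)
    qed
    then have "L (\<lambda>d. ?g (diag_unit k d)) = 1"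
      by (intro L_lim bdd gd) (auto simp: eventually_sequentially)
    then have "canonical (dual ?X) ?g (\<phi> k) = 1"
      using \<phi>[of k] gd by (simp add: canonical_def \<phi>_def)
    moreover have "canonical (dual ?X) ?g \<in> unit_ball (dual (bidual ?X))"
      using canonical_in_bidual[OF X' gd] nrm_canonical_le[OF X' gd] g by (auto simp: unit_ball_def)
    ultimately show ?thesis by (intro bexI[of _ "canonical (dual ?X) ?g"]) auto
  qed
  \<comment> \<open>Functionals vanish off the carrier, so the adjoint of the identity is the identity of the dual.\<close>
  have fix_\<phi>: "biadjoint_op ?X ?X (\<lambda>x. x) (\<phi> k) = \<phi> k" for k
  proof
    fix g
    have "adjoint_op ?X (\<lambda>x. x) g = g" if "g \<in> carr (dual ?X)"
      using dual_apply(3)[OF that] by (auto simp: adjoint_op_def fun_eq_iff)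
    then show "biadjoint_op ?X ?X (\<lambda>x. x) (\<phi> k) g = \<phi> k g"
      by (simp add: biadjoint_op_def adjoint_op_def[of "dual ?X"] \<phi>_def)
  qed
  show ?thesis
    by (rule not_uncond_converging_if_signs[OF normed_space_dual[OF X'] \<phi> signs far fix_\<phi> p])
qed

lemma uncond_converging_with_bad_biadjoint:
  assumes "1 \<le> p"
  shows "\<exists>(X :: ('k::{real_normed_field, banach, heine_borel}, nat \<Rightarrow> 'k) nspace) (Y :: ('k, nat \<Rightarrow> 'k) nspace) T.
    banach_space X \<and> banach_space Y \<and> T \<in> operators X Y \<and> uncond_converging p X Y T \<and>
    \<not> uncond_converging p (bidual X) (bidual Y) (biadjoint_op X Y T)"
proof (intro exI conjI)
  note X = normed_space_l1_linf[where 'k = 'k]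
  show "(\<lambda>x. x) \<in> operators l1_linf (l1_linf :: ('k, nat \<Rightarrow> 'k) nspace)"
    by (rule operatorsI[OF X X, where C = 1]) auto
  show "uncond_converging p l1_linf (l1_linf :: ('k, nat \<Rightarrow> 'k) nspace) (\<lambda>x. x)"
    by (rule schur_id_uncond_converging[OF X schur_property_l1_linf assms])
qed (rule banach_space_l1_linf bidual_l1_linf_not_uncond_converging assms)+

theorem theorem2p7:
  shows
    "(\<forall>(X :: (real, 'a::ab_group_add) nspace) (Y :: (real, 'b::ab_group_add) nspace) T (p :: ereal).
        banach_space X \<and> banach_space Y \<and> T \<in> operators X Y \<and> 1 \<le> p \<and>
        uncond_converging p (bidual X) (bidual Y) (biadjoint_op X Y T)
        \<longrightarrow> uncond_converging p X Y T) \<and>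
     (\<forall>(X :: (complex, 'a) nspace) (Y :: (complex, 'b) nspace) T (p :: ereal).
        banach_space X \<and> banach_space Y \<and> T \<in> operators X Y \<and> 1 \<le> p \<and>
        uncond_converging p (bidual X) (bidual Y) (biadjoint_op X Y T)
        \<longrightarrow> uncond_converging p X Y T) \<and>
     (\<forall>p :: ereal. 1 \<le> p \<longrightarrow>
        (\<exists>(X :: (real, nat \<Rightarrow> real) nspace) (Y :: (real, nat \<Rightarrow> real) nspace) T.
           banach_space X \<and> banach_space Y \<and> T \<in> operators X Y \<and>
           uncond_converging p X Y T \<and>
           \<not> uncond_converging p (bidual X) (bidual Y) (biadjoint_op X Y T))) \<and>
     (\<forall>p :: ereal. 1 \<le> p \<longrightarrow>
        (\<exists>(X :: (complex, nat \<Rightarrow> complex) nspace) (Y :: (complex, nat \<Rightarrow> complex) nspace) T.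
           banach_space X \<and> banach_space Y \<and> T \<in> operators X Y \<and>
           uncond_converging p X Y T \<and>
           \<not> uncond_converging p (bidual X) (bidual Y) (biadjoint_op X Y T)))"
proof (intro conjI allI impI)
  fix X :: "(real, 'a) nspace" and Y :: "(real, 'b) nspace" and T p
  assume "banach_space X \<and> banach_space Y \<and> T \<in> operators X Y \<and> 1 \<le> p \<and>
    uncond_converging p (bidual X) (bidual Y) (biadjoint_op X Y T)"
  then show "uncond_converging p X Y T"
    by (auto simp: banach_space_def intro: uncond_converging_of_biadjoint norming_functional_real)
next
  fix X :: "(complex, 'a) nspace" and Y :: "(complex, 'b) nspace" and T p
  assume "banach_space X \<and> banach_space Y \<and> T \<in> operators X Y \<and> 1 \<le> p \<and>
    uncond_converging p (bidual X) (bidual Y) (biadjoint_op X Y T)"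
  then show "uncond_converging p X Y T"
    by (auto simp: banach_space_def intro: uncond_converging_of_biadjoint norming_functional_complex)
qed (rule uncond_converging_with_bad_biadjoint, assumption)+

end
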